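(* Let $\mathcal{A}$ be a semi-abelian category satisfying the Smith is Huq condition (SH), and let $(\mu\colon M\to L,\ \xi^L_M)$ and $(\nu\colon N\to L,\ \xi^L_N)$ be internal crossed modules in $\mathcal{A}$ over the same object $L$. Then $\xi^M_N:=\xi^L_N\circ(\mu\flat 1_N)\colon M\flat N\to N$ and $\xi^N_M:=\xi^L_M\circ(\nu\flat 1_M)\colon N\flat M\to M$ are internal actions, and they are compatible.
   Context: A semi-abelian category is a pointed, Barr exact, Bourn protomodular category with binary coproducts. (SH): two internal equivalence relations on the same object centralise each other in the Smith–Pedicchio sense as soon as their normalisations (the corresponding normal subobjects) commute in the sense of Huq. Notation: $+$ is the coproduct (with $A+B$ and $B+A$ identified), $i_A\colon A\to A+B$ and $i_B\colon B\to A+B$ are the inclusions, $[f,g]\colon A+B\to C$ is the morphism induced by $f\colon A\to C$, $g\colon B\to C$. The functor $\flat$: $k_{A,B}\colon A\flat B\to A+B$ is the kernel of $[1_A,0]\colon A+B\to A$; for $f\colon A\to A'$, $g\colon B\to B'$, $f\flat g$ is the restriction of $f+g$ to kernels. For fixed $A$, $A\flat(-)$ is a monad with unit $\eta^A_B\colon B\to A\flat B$ determined by $k_{A,B}\circ\eta^A_B=i_B$ and multiplication $\mu^A_B\colon A\flat(A\flat B)\to A\flat B$ determined by $k_{A,B}\circ\mu^A_B=[i_A,k_{A,B}]\circ k_{A,A\flat B}$. An internal action of $A$ on $X$ is a morphism $\xi\colon A\flat X\to X$ making $X$ an algebra for this monad. The conjugation action is $\chi_A=[1_A,1_A]\circ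 k_{A,A}\colon A\flat A\to A$. Internal crossed module (under (SH)): a pair $(\partial\colon X\to A,\xi)$ with $\xi\colon A\flat X\to X$ an internal action such that $\xi\circ(\partial\flat 1_X)=\chi_X$ and $\partial\circ\xi=\chi_A\circ(1_A\flat\partial)$. Cosmash products: $h_{A,B}\colon A\diamond B\to A+B$ is the kernel of the canonical morphism $A+B\to A\times B$; it factors as $h_{A,B}=k_{A,B}\circ i_{A,B}$ with $i_{A,B}\colon A\diamond B\to A\flat B$. $h_{A,B,C}\colon A\diamond B\diamond C\to A+B+C$ is the kernel of the morphism $A+B+C\to(A+B)\times(A+C)\times(B+C)$ with components $[i_A,i_B,0]$, $[i_A,0,i_C]$, $[0,i_B,i_C]$. The morphism $j_{A,B,C}\colon A\diamond B\diamond C\to(A+B)\flat C$ is the unique one with $k_{A+B,C}\circ j_{A,B,C}=h_{A,B,C}$. The folding morphism $S^{N,M}_{1,2}\colon M\diamond N\diamond M\to N\diamond M$ is the unique one such that $h_{N,M}\circ S^{N,M}_{1,2}$ equals $h_{M,N,M}$ followed by the morphism $M+N+M\to M+N$ which folds the two copies of $M$ by the codiagonal and is the identity on $N$. Similarly $S^{M,N}_{1,2}\colon M\diamond N\diamond N\to M\diamond N$ is induced by folding the two copies of $N$. Compatibility: internal actions $\xi^M_N\colon M\flat N\to N$ and $\xi^N_M\colon N\flat M\to M$ are compatible if there exist internal actions $\xi^{M+N}_M\colon(M+N)\flat M\to M$ and $\xi^{M+N}_N\colon(M+N)\flat N\to N$ such that: (CA.0) $\xi^{M+N}_M\circ(i_N\flat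 1_M)=\xi^N_M$, $\ \xi^{M+N}_M\circ(i_M\flat 1_M)=\chi_M$, $\ \xi^{M+N}_M\circ j_{M,N,M}=\xi^N_M\circ i_{N,M}\circ S^{N,M}_{1,2}$, and $\xi^{M+N}_N\circ(i_M\flat 1_N)=\xi^M_N$, $\ \xi^{M+N}_N\circ(i_N\flat 1_N)=\chi_N$, $\ \xi^{M+N}_N\circ j_{M,N,N}=\xi^M_N\circ i_{M,N}\circ S^{M,N}_{1,2}$; (CA.M) $\xi^{M+N}_M\circ\big((\xi^N_M+\xi^M_N)\flat 1_M\big)=\xi^{M+N}_M\circ\big([k_{N,M},k_{M,N}]\flat 1_M\big)$ as morphisms $((N\flat M)+(M\flat N))\flat M\to M$; (CA.N) $\xi^{M+N}_N\circ\big((\xi^N_M+\xi^M_N)\flat 1_N\big)=\xi^{M+N}_N\circ\big([k_{N,M},k_{M,N}]\flat 1_N\big)$ as morphisms $((N\flat M)+(M\flat N))\flat N\to N$. *)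

theory Defs
  imports Main
begin

section \<open>Categories\<close>

record ('o, 'm) cat =
  Ob :: "'o set"
  Ar :: "'m set"
  Dom :: "'m \<Rightarrow> 'o"
  Cod :: "'m \<Rightarrow> 'o"
  Ide :: "'o \<Rightarrow> 'm"
  Comp :: "'m \<Rightarrow> 'm \<Rightarrow> 'm"  (infixl "\<cdot>\<index>" 70)

definition Hom :: "('o, 'm, 'z) cat_scheme \<Rightarrow> 'o \<Rightarrow> 'o \<Rightarrow> 'm set" where
  "Hom C A B = {f \<in> Ar C. Dom C f = A \<and> Cod C f = B}"

locale category =
  fixes C :: "('o, 'm, 'z) cat_scheme" (structure)
  assumes Dom_Ob: "f \<in> Ar C \<Longrightarrow> Dom C f \<in> Ob C"
    and Cod_Ob: "f \<in> Ar C \<Longrightarrow> Cod C f \<in> Ob C"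
    and Ide_Hom: "A \<in> Ob C \<Longrightarrow> Ide C A \<in> Hom C A A"
    and Comp_Hom: "f \<in> Hom C X Y \<Longrightarrow> g \<in> Hom C Y Z \<Longrightarrow> g \<cdot> f \<in> Hom C X Z"
    and Ide_left: "f \<in> Hom C X Y \<Longrightarrow> Ide C Y \<cdot> f = f"
    and Ide_right: "f \<in> Hom C X Y \<Longrightarrow> f \<cdot> Ide C X = f"
    and Comp_assoc: "f \<in> Hom C W X \<Longrightarrow> g \<in> Hom C X Y \<Longrightarrow> h \<in> Hom C Y Z \<Longrightarrow>
      h \<cdot> (g \<cdot> f) = (h \<cdot> g) \<cdot> f"

context
  fixes C :: "('o, 'm, 'z) cat_scheme" (structure)
begin

definition is_iso :: "'m \<Rightarrow> bool" where
  "is_iso f \<longleftrightarrow> f \<in> Ar C \<and>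
    (\<exists>g\<in>Hom C (Cod C f) (Dom C f). g \<cdot> f = Ide C (Dom C f) \<and> f \<cdot> g = Ide C (Cod C f))"

definition is_terminal :: "'o \<Rightarrow> bool" where
  "is_terminal T \<longleftrightarrow> T \<in> Ob C \<and> (\<forall>X\<in>Ob C. \<exists>!f. f \<in> Hom C X T)"

definition is_initial :: "'o \<Rightarrow> bool" where
  "is_initial I \<longleftrightarrow> I \<in> Ob C \<and> (\<forall>X\<in>Ob C. \<exists>!f. f \<in> Hom C I X)"

definition is_zero_object :: "'o \<Rightarrow> bool" where
  "is_zero_object Z \<longleftrightarrow> is_initial Z \<and> is_terminal Z"

definition is_product :: "'o \<Rightarrow> 'm \<Rightarrow> 'm \<Rightarrow> 'o \<Rightarrow> 'o \<Rightarrow> bool" where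
  "is_product P p q A B \<longleftrightarrow> P \<in> Ob C \<and> p \<in> Hom C P A \<and> q \<in> Hom C P B \<and>
    (\<forall>X\<in>Ob C. \<forall>f\<in>Hom C X A. \<forall>g\<in>Hom C X B. \<exists>!h. h \<in> Hom C X P \<and> p \<cdot> h = f \<and> q \<cdot> h = g)"

definition is_coproduct :: "'o \<Rightarrow> 'm \<Rightarrow> 'm \<Rightarrow> 'o \<Rightarrow> 'o \<Rightarrow> bool" where
  "is_coproduct S i j A B \<longleftrightarrow> S \<in> Ob C \<and> i \<in> Hom C A S \<and> j \<in> Hom C B S \<and>
    (\<forall>X\<in>Ob C. \<forall>f\<in>Hom C A X. \<forall>g\<in>Hom C B X. \<exists>!h. h \<in> Hom C S X \<and> h \<cdot> i = f \<and> h \<cdot> j = g)"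

definition is_equalizer :: "'o \<Rightarrow> 'm \<Rightarrow> 'm \<Rightarrow> 'm \<Rightarrow> bool" where
  "is_equalizer E e f g \<longleftrightarrow> E \<in> Ob C \<and> e \<in> Hom C E (Dom C f) \<and> f \<cdot> e = g \<cdot> e \<and>
    (\<forall>X\<in>Ob C. \<forall>x\<in>Hom C X (Dom C f). f \<cdot> x = g \<cdot> x \<longrightarrow> (\<exists>!h. h \<in> Hom C X E \<and> e \<cdot> h = x))"

definition is_coequalizer :: "'o \<Rightarrow> 'm \<Rightarrow> 'm \<Rightarrow> 'm \<Rightarrow> bool" where
  "is_coequalizer Q q f g \<longleftrightarrow> Q \<in> Ob C \<and> q \<in> Hom C (Cod C f) Q \<and> q \<cdot> f = q \<cdot> g \<and>
    (\<forall>X\<in>Ob C. \<forall>x\<in>Hom C (Cod C f) X. x \<cdot> f = x \<cdot> g \<longrightarrow> (\<exists>!h. h \<in> Hom C Q X \<and> h \<cdot> q = x))"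

definition is_pullback :: "'o \<Rightarrow> 'm \<Rightarrow> 'm \<Rightarrow> 'm \<Rightarrow> 'm \<Rightarrow> bool" where
  "is_pullback P p q f g \<longleftrightarrow> P \<in> Ob C \<and> f \<in> Ar C \<and> g \<in> Ar C \<and> Cod C f = Cod C g \<and>
    p \<in> Hom C P (Dom C f) \<and> q \<in> Hom C P (Dom C g) \<and> f \<cdot> p = g \<cdot> q \<and>
    (\<forall>X\<in>Ob C. \<forall>x\<in>Hom C X (Dom C f). \<forall>y\<in>Hom C X (Dom C g). f \<cdot> x = g \<cdot> y \<longrightarrow>
      (\<exists>!h. h \<in> Hom C X P \<and> p \<cdot> h = x \<and> q \<cdot> h = y))"

definition pointed :: bool where
  "pointed \<longleftrightarrow> (\<exists>Z. is_zero_object Z)"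

definition zero_mor :: "'o \<Rightarrow> 'o \<Rightarrow> 'm" where
  "zero_mor A B = (THE f. \<exists>Z g h. is_zero_object Z \<and> g \<in> Hom C A Z \<and> h \<in> Hom C Z B \<and> f = h \<cdot> g)"

definition is_kernel :: "'o \<Rightarrow> 'm \<Rightarrow> 'm \<Rightarrow> bool" where
  "is_kernel K k f \<longleftrightarrow> f \<in> Ar C \<and> is_equalizer K k f (zero_mor (Dom C f) (Cod C f))"

section \<open>Semi-abelian categories\<close>

definition finitely_complete :: bool where
  "finitely_complete \<longleftrightarrow> (\<exists>T. is_terminal T) \<and>
    (\<forall>A\<in>Ob C. \<forall>B\<in>Ob C. \<exists>P p q. is_product P p q A B) \<and>
    (\<forall>A\<in>Ob C. \<forall>B\<in>Ob C. \<forall>f\<in>Hom C A B. \<forall>g\<in>Hom C A B. \<exists>E e. is_equalizer E e f g)"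

definition has_binary_coproducts :: bool where
  "has_binary_coproducts \<longleftrightarrow> (\<forall>A\<in>Ob C. \<forall>B\<in>Ob C. \<exists>S i j. is_coproduct S i j A B)"

definition regular_epi :: "'m \<Rightarrow> bool" where
  "regular_epi q \<longleftrightarrow> q \<in> Ar C \<and>
    (\<exists>A f g. f \<in> Hom C A (Dom C q) \<and> g \<in> Hom C A (Dom C q) \<and> is_coequalizer (Cod C q) q f g)"

definition kernel_pair :: "'o \<Rightarrow> 'm \<Rightarrow> 'm \<Rightarrow> 'm \<Rightarrow> bool" where
  "kernel_pair R r1 r2 f \<longleftrightarrow> is_pullback R r1 r2 f f"

definition regular_cat :: bool where
  "regular_cat \<longleftrightarrow> finitely_complete \<and>
    (\<forall>R r1 r2 f. kernel_pair R r1 r2 f \<longrightarrow> (\<exists>Q q. is_coequalizer Q q r1 r2)) \<and>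
    (\<forall>P p q f g. is_pullback P p q f g \<and> regular_epi f \<longrightarrow> regular_epi q)"

definition equivalence_relation :: "'o \<Rightarrow> 'm \<Rightarrow> 'm \<Rightarrow> 'o \<Rightarrow> bool" where
  "equivalence_relation R r1 r2 X \<longleftrightarrow> R \<in> Ob C \<and> X \<in> Ob C \<and> r1 \<in> Hom C R X \<and> r2 \<in> Hom C R X \<and>
    (\<forall>T\<in>Ob C. \<forall>x\<in>Hom C T R. \<forall>y\<in>Hom C T R. r1 \<cdot> x = r1 \<cdot> y \<and> r2 \<cdot> x = r2 \<cdot> y \<longrightarrow> x = y) \<and>
    (\<exists>d\<in>Hom C X R. r1 \<cdot> d = Ide C X \<and> r2 \<cdot> d = Ide C X) \<and>
    (\<exists>s\<in>Hom C R R. r1 \<cdot> s = r2 \<and> r2 \<cdot> s = r1) \<and>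
    (\<forall>P p q. is_pullback P p q r2 r1 \<longrightarrow>
      (\<exists>t\<in>Hom C P R. r1 \<cdot> t = r1 \<cdot> p \<and> r2 \<cdot> t = r2 \<cdot> q))"

definition barr_exact :: bool where
  "barr_exact \<longleftrightarrow> regular_cat \<and>
    (\<forall>R r1 r2 X. equivalence_relation R r1 r2 X \<longrightarrow> (\<exists>f. kernel_pair R r1 r2 f))"

definition is_point :: "'o \<Rightarrow> 'm \<Rightarrow> 'm \<Rightarrow> 'o \<Rightarrow> bool" where
  "is_point A p s B \<longleftrightarrow> A \<in> Ob C \<and> B \<in> Ob C \<and> p \<in> Hom C A B \<and> s \<in> Hom C B A \<and> p \<cdot> s = Ide C B"

text \<open>The pullback functors between categories of points reflect isomorphisms: here \<open>f\<close> is a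
  morphism of points over \<open>B\<close> and \<open>g\<close> is its image under pulling back along \<open>v: E \<rightarrow> B\<close>. (A morphism
  of points is an isomorphism of points as soon as the underlying arrow is an isomorphism.)\<close>

definition protomodular :: bool where
  "protomodular \<longleftrightarrow> (\<forall>E B v A p s A' p' s' f P u q P' u' q' g.
    v \<in> Hom C E B \<and> is_point A p s B \<and> is_point A' p' s' B \<and>
    f \<in> Hom C A A' \<and> p' \<cdot> f = p \<and> f \<cdot> s = s' \<and>
    is_pullback P u q p v \<and> is_pullback P' u' q' p' v \<and>
    g \<in> Hom C P P' \<and> u' \<cdot> g = f \<cdot> u \<and> q' \<cdot> g = q \<and> is_iso g
    \<longrightarrow> is_iso f)"

definition semi_abelian :: bool where
  "semi_abelian \<longleftrightarrow> category C \<and> pointed \<and> barr_exact \<and> protomodular \<and> has_binary_coproducts"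

section \<open>The Smith is Huq condition\<close>

text \<open>The normalisation of \<open>(R, r1, r2)\<close> is the composite of \<open>r2\<close> with the kernel of \<open>r1\<close>.\<close>

definition normalisation :: "'o \<Rightarrow> 'm \<Rightarrow> 'o \<Rightarrow> 'm \<Rightarrow> 'm \<Rightarrow> bool" where
  "normalisation K n R r1 r2 \<longleftrightarrow> (\<exists>k. is_kernel K k r1 \<and> n = r2 \<cdot> k)"

text \<open>Huq: there is \<open>\<phi>: K \<times> L \<rightarrow> X\<close> restricting to \<open>k\<close> along \<open>\<langle>1,0\<rangle>\<close> and to \<open>l\<close> along \<open>\<langle>0,1\<rangle>\<close>.\<close>

definition huq_commute :: "'o \<Rightarrow> 'm \<Rightarrow> 'o \<Rightarrow> 'm \<Rightarrow> 'o \<Rightarrow> bool" where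
  "huq_commute K k L l X \<longleftrightarrow> k \<in> Hom C K X \<and> l \<in> Hom C L X \<and>
    (\<exists>P p q a b \<phi>. is_product P p q K L \<and>
      a \<in> Hom C K P \<and> p \<cdot> a = Ide C K \<and> q \<cdot> a = zero_mor K L \<and>
      b \<in> Hom C L P \<and> p \<cdot> b = zero_mor L K \<and> q \<cdot> b = Ide C L \<and>
      \<phi> \<in> Hom C P X \<and> \<phi> \<cdot> a = k \<and> \<phi> \<cdot> b = l)"

text \<open>Smith--Pedicchio: there is a connector \<open>\<theta>: R \<times>\<^sub>X S \<rightarrow> X\<close>, where \<open>R \<times>\<^sub>X S\<close> is the pullback of
  \<open>r2\<close> and \<open>s1\<close>; in terms of elements, \<open>\<theta>(x,y,y) = x\<close> and \<open>\<theta>(y,y,z) = z\<close>. Here \<open>a\<close> is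
  \<open>(x,y) \<mapsto> (x,y,y)\<close> and \<open>b\<close> is \<open>(y,z) \<mapsto> (y,y,z)\<close>. In a Mal'tsev category, hence in a semi-abelian
  one, the remaining axioms of a connector are consequences of these two.\<close>

definition smith_centralise :: "'o \<Rightarrow> 'm \<Rightarrow> 'm \<Rightarrow> 'o \<Rightarrow> 'm \<Rightarrow> 'm \<Rightarrow> 'o \<Rightarrow> bool" where
  "smith_centralise R r1 r2 S s1 s2 X \<longleftrightarrow>
    (\<exists>P p q dR dS a b \<theta>. is_pullback P p q r2 s1 \<and>
      dR \<in> Hom C X R \<and> r1 \<cdot> dR = Ide C X \<and> r2 \<cdot> dR = Ide C X \<and>
      dS \<in> Hom C X S \<and> s1 \<cdot> dS = Ide C X \<and> s2 \<cdot> dS = Ide C X \<and>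
      a \<in> Hom C R P \<and> p \<cdot> a = Ide C R \<and> q \<cdot> a = dS \<cdot> r2 \<and>
      b \<in> Hom C S P \<and> p \<cdot> b = dR \<cdot> s1 \<and> q \<cdot> b = Ide C S \<and>
      \<theta> \<in> Hom C P X \<and> \<theta> \<cdot> a = r1 \<and> \<theta> \<cdot> b = s2)"

definition smith_is_huq :: bool where
  "smith_is_huq \<longleftrightarrow> (\<forall>X R r1 r2 S s1 s2 K k L l.
    equivalence_relation R r1 r2 X \<and> equivalence_relation S s1 s2 X \<and>
    normalisation K k R r1 r2 \<and> normalisation L l S s1 s2 \<and> huq_commute K k L l X
    \<longrightarrow> smith_centralise R r1 r2 S s1 s2 X)"

end

section \<open>Chosen products, coproducts and kernels\<close>

text \<open>The functors below depend on a choice of binary (co)products and kernels. The choice is arbitrary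
  and exists in every semi-abelian category. The chosen \<open>A + B\<close> and \<open>B + A\<close> need not be equal; the
  canonical isomorphism between them is written explicitly wherever the two are to be identified.\<close>

record ('o, 'm) choice_cat = "('o, 'm) cat" +
  Prod :: "'o \<Rightarrow> 'o \<Rightarrow> 'o"
  Fst :: "'o \<Rightarrow> 'o \<Rightarrow> 'm"
  Snd :: "'o \<Rightarrow> 'o \<Rightarrow> 'm"
  Coprod :: "'o \<Rightarrow> 'o \<Rightarrow> 'o"  (infixl "\<amalg>\<index>" 65)
  In1 :: "'o \<Rightarrow> 'o \<Rightarrow> 'm"
  In2 :: "'o \<Rightarrow> 'o \<Rightarrow> 'm"
  Ker :: "'m \<Rightarrow> 'o"
  ker :: "'m \<Rightarrow> 'm"

locale chosen_limits =
  fixes C :: "('o, 'm, 'z) choice_cat_scheme" (structure)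
  assumes Prod: "A \<in> Ob C \<Longrightarrow> B \<in> Ob C \<Longrightarrow> is_product C (Prod C A B) (Fst C A B) (Snd C A B) A B"
    and Coprod: "A \<in> Ob C \<Longrightarrow> B \<in> Ob C \<Longrightarrow> is_coproduct C (A \<amalg> B) (In1 C A B) (In2 C A B) A B"
    and Ker: "f \<in> Ar C \<Longrightarrow> is_kernel C (Ker C f) (ker C f) f"

context
  fixes C :: "('o, 'm, 'z) choice_cat_scheme" (structure)
begin

definition pair :: "'m \<Rightarrow> 'm \<Rightarrow> 'm" where
  "pair f g = (let A = Cod C f; B = Cod C g in
    THE h. h \<in> Hom C (Dom C f) (Prod C A B) \<and> Fst C A B \<cdot> h = f \<and> Snd C A B \<cdot> h = g)"

definition copair :: "'m \<Rightarrow> 'm \<Rightarrow> 'm" where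
  "copair f g = (let A = Dom C f; B = Dom C g in
    THE h. h \<in> Hom C (A \<amalg> B) (Cod C f) \<and> h \<cdot> In1 C A B = f \<and> h \<cdot> In2 C A B = g)"

definition coprod_map :: "'m \<Rightarrow> 'm \<Rightarrow> 'm" where
  "coprod_map f g =
    copair (In1 C (Cod C f) (Cod C g) \<cdot> f) (In2 C (Cod C f) (Cod C g) \<cdot> g)"

definition coprod_swap :: "'o \<Rightarrow> 'o \<Rightarrow> 'm" where
  "coprod_swap A B = copair (In2 C B A) (In1 C B A)" \<comment> \<open>from \<open>A + B\<close> to \<open>B + A\<close>\<close>

section \<open>Internal actions and crossed modules\<close>

definition flat :: "'o \<Rightarrow> 'o \<Rightarrow> 'o" where
  "flat A B = Ker C (copair (Ide C A) (zero_mor C B A))"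

definition flat_ker :: "'o \<Rightarrow> 'o \<Rightarrow> 'm" where
  "flat_ker A B = ker C (copair (Ide C A) (zero_mor C B A))"

definition flat_map :: "'m \<Rightarrow> 'm \<Rightarrow> 'm" where
  "flat_map f g = (THE h. h \<in> Hom C (flat (Dom C f) (Dom C g)) (flat (Cod C f) (Cod C g)) \<and>
    flat_ker (Cod C f) (Cod C g) \<cdot> h = coprod_map f g \<cdot> flat_ker (Dom C f) (Dom C g))"

definition flat_unit :: "'o \<Rightarrow> 'o \<Rightarrow> 'm" where
  "flat_unit A B = (THE h. h \<in> Hom C B (flat A B) \<and> flat_ker A B \<cdot> h = In2 C A B)"

definition flat_mult :: "'o \<Rightarrow> 'o \<Rightarrow> 'm" where
  "flat_mult A B = (THE h. h \<in> Hom C (flat A (flat A B)) (flat A B) \<and>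
    flat_ker A B \<cdot> h = copair (In1 C A B) (flat_ker A B) \<cdot> flat_ker A (flat A B))"

definition internal_action :: "'o \<Rightarrow> 'o \<Rightarrow> 'm \<Rightarrow> bool" where
  "internal_action A X \<xi> \<longleftrightarrow> A \<in> Ob C \<and> X \<in> Ob C \<and> \<xi> \<in> Hom C (flat A X) X \<and>
    \<xi> \<cdot> flat_unit A X = Ide C X \<and> \<xi> \<cdot> flat_mult A X = \<xi> \<cdot> flat_map (Ide C A) \<xi>"

definition conj_action :: "'o \<Rightarrow> 'm" where
  "conj_action A = copair (Ide C A) (Ide C A) \<cdot> flat_ker A A"

definition crossed_module :: "'o \<Rightarrow> 'o \<Rightarrow> 'm \<Rightarrow> 'm \<Rightarrow> bool" where
  "crossed_module X A d \<xi> \<longleftrightarrow> d \<in> Hom C X A \<and> internal_action A X \<xi> \<and>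
    \<xi> \<cdot> flat_map d (Ide C X) = conj_action X \<and>
    d \<cdot> \<xi> = conj_action A \<cdot> flat_map (Ide C A) d"

section \<open>Cosmash products\<close>

definition coprod_to_prod :: "'o \<Rightarrow> 'o \<Rightarrow> 'm" where
  "coprod_to_prod A B = pair (copair (Ide C A) (zero_mor C B A)) (copair (zero_mor C A B) (Ide C B))"

definition cosmash :: "'o \<Rightarrow> 'o \<Rightarrow> 'o" where
  "cosmash A B = Ker C (coprod_to_prod A B)"

definition cosmash_ker :: "'o \<Rightarrow> 'o \<Rightarrow> 'm" where
  "cosmash_ker A B = ker C (coprod_to_prod A B)"

definition cosmash_to_flat :: "'o \<Rightarrow> 'o \<Rightarrow> 'm" where
  "cosmash_to_flat A B =
    (THE h. h \<in> Hom C (cosmash A B) (flat A B) \<and> flat_ker A B \<cdot> h = cosmash_ker A B)"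

text \<open>Ternary coproducts are bracketed as \<open>(A + B) + D\<close>.\<close>

definition coprod3_to_prod :: "'o \<Rightarrow> 'o \<Rightarrow> 'o \<Rightarrow> 'm" where
  "coprod3_to_prod A B D =
    pair (copair (copair (In1 C A B) (In2 C A B)) (zero_mor C D (A \<amalg> B)))
      (pair (copair (copair (In1 C A D) (zero_mor C B (A \<amalg> D))) (In2 C A D))
            (copair (copair (zero_mor C A (B \<amalg> D)) (In1 C B D)) (In2 C B D)))"

definition cosmash3 :: "'o \<Rightarrow> 'o \<Rightarrow> 'o \<Rightarrow> 'o" where
  "cosmash3 A B D = Ker C (coprod3_to_prod A B D)"

definition cosmash3_ker :: "'o \<Rightarrow> 'o \<Rightarrow> 'o \<Rightarrow> 'm" where
  "cosmash3_ker A B D = ker C (coprod3_to_prod A B D)"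

definition cosmash3_to_flat :: "'o \<Rightarrow> 'o \<Rightarrow> 'o \<Rightarrow> 'm" where
  "cosmash3_to_flat A B D = (THE h. h \<in> Hom C (cosmash3 A B D) (flat (A \<amalg> B) D) \<and>
    flat_ker (A \<amalg> B) D \<cdot> h = cosmash3_ker A B D)"

text \<open>The two foldings \<open>S\<^sub>1\<^sub>,\<^sub>2\<close>: the first is \<open>B \<diamondop> A \<diamondop> B \<rightarrow> A \<diamondop> B\<close>, the second is
  \<open>A \<diamondop> B \<diamondop> B \<rightarrow> A \<diamondop> B\<close>; both fold the two copies of \<open>B\<close>.\<close>

definition fold_outer :: "'o \<Rightarrow> 'o \<Rightarrow> 'm" where
  "fold_outer A B = (THE h. h \<in> Hom C (cosmash3 B A B) (cosmash A B) \<and>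
    cosmash_ker A B \<cdot> h =
      copair (copair (In2 C A B) (In1 C A B)) (In2 C A B) \<cdot> cosmash3_ker B A B)"

definition fold_right :: "'o \<Rightarrow> 'o \<Rightarrow> 'm" where
  "fold_right A B = (THE h. h \<in> Hom C (cosmash3 A B B) (cosmash A B) \<and>
    cosmash_ker A B \<cdot> h =
      copair (copair (In1 C A B) (In2 C A B)) (In2 C A B) \<cdot> cosmash3_ker A B B)"

section \<open>Compatible actions\<close>

text \<open>The morphism \<open>[k\<^sub>N\<^sub>,\<^sub>M, k\<^sub>M\<^sub>,\<^sub>N] : (N \<flat> M) + (M \<flat> N) \<rightarrow> M + N\<close>, in which \<open>N + M\<close> is identified with \<open>M + N\<close>.\<close>

definition flat_kers :: "'o \<Rightarrow> 'o \<Rightarrow> 'm" where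
  "flat_kers M N = copair (coprod_swap N M \<cdot> flat_ker N M) (flat_ker M N)"

text \<open>Here \<open>\<alpha> : M \<flat> N \<rightarrow> N\<close> and \<open>\<beta> : N \<flat> M \<rightarrow> M\<close> are the given actions, and \<open>\<alpha>'\<close>, \<open>\<beta>'\<close> the
  actions of \<open>M + N\<close> on \<open>N\<close> and on \<open>M\<close>.\<close>

definition compatible_actions :: "'o \<Rightarrow> 'o \<Rightarrow> 'm \<Rightarrow> 'm \<Rightarrow> bool" where
  "compatible_actions M N \<alpha> \<beta> \<longleftrightarrow> internal_action M N \<alpha> \<and> internal_action N M \<beta> \<and>
    (\<exists>\<beta>' \<alpha>'. internal_action (M \<amalg> N) M \<beta>' \<and> internal_action (M \<amalg> N) N \<alpha>' \<and>
      \<comment> \<open>CA.0\<close>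
      \<beta>' \<cdot> flat_map (In2 C M N) (Ide C M) = \<beta> \<and>
      \<beta>' \<cdot> flat_map (In1 C M N) (Ide C M) = conj_action M \<and>
      \<beta>' \<cdot> cosmash3_to_flat M N M = \<beta> \<cdot> cosmash_to_flat N M \<cdot> fold_outer N M \<and>
      \<alpha>' \<cdot> flat_map (In1 C M N) (Ide C N) = \<alpha> \<and>
      \<alpha>' \<cdot> flat_map (In2 C M N) (Ide C N) = conj_action N \<and>
      \<alpha>' \<cdot> cosmash3_to_flat M N N = \<alpha> \<cdot> cosmash_to_flat M N \<cdot> fold_right M N \<and>
      \<comment> \<open>CA.M\<close>
      \<beta>' \<cdot> flat_map (coprod_map \<beta> \<alpha>) (Ide C M) = \<beta>' \<cdot> flat_map (flat_kers M N) (Ide C M) \<and>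
      \<comment> \<open>CA.N\<close>
      \<alpha>' \<cdot> flat_map (coprod_map \<beta> \<alpha>) (Ide C N) = \<alpha>' \<cdot> flat_map (flat_kers M N) (Ide C N))"

end

end

theory Submission
  imports Defs
begin

text \<open>Both actions of \<open>M + N\<close> are pulled back from \<open>L\<close> along \<open>[\<mu>, \<nu>]\<close>. Then (CA.M) and (CA.N) hold because
  \<open>[\<mu>, \<nu>]\<close> does not distinguish \<open>\<xi>\<^sup>N\<^sub>M + \<xi>\<^sup>M\<^sub>N\<close> from \<open>[k, k]\<close>, which is equivariance of \<open>\<mu>\<close> and \<open>\<nu>\<close>.
  Only the ternary equations of (CA.0) need (SH).

  For a crossed module \<open>\<partial> : X \<rightarrow> A\<close>, let \<open>G = A \<ltimes> X\<close> be the semidirect product, with projection \<open>p\<close>, section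
  \<open>s\<close>, kernel \<open>\<kappa> : X \<rightarrow> G\<close> and \<open>c = [1, \<partial>] : G \<rightarrow> A\<close>. The Peiffer condition makes \<open>ker p\<close> and \<open>ker c\<close>
  commute in the sense of Huq, so by (SH) the kernel pairs of \<open>p\<close> and \<open>c\<close> have a connector. It follows that
  conjugation of \<open>X\<close> by an element \<open>g\<close> of \<open>G\<close> equals conjugation by \<open>s (c g)\<close>. For \<open>g = [\<kappa>, s \<nu>]\<close>
  and \<open>g = [s \<mu>, \<kappa>]\<close> these are the two ternary equations.\<close>

text \<open>What shapes the proof is that no inverses are at hand. In groups an element of
  \<open>ker c\<close> has the form s(\<partial> x)^-1 x, and one checks directly that it commutes
  with \<open>X\<close>. The substitute is a division map on pairs of elements of \<open>X\<close>,
  which protomodularity extracts from the Peiffer condition; every element of \<open>ker c\<close>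
  is locally such a quotient. That the required divisor exists comes from the Mal'tsev property: the
  image of \<open>(p, c)\<close> is reflexive, hence symmetric. "Locally" means after composition
  with a regular epimorphism: stability under pullback supplies preimages, and results descend
  because regular epimorphisms are cokernels. (SH) enters because Peiffer controls only conjugation
  by elements of \<open>X\<close>, while the ternary equations conjugate by a \<open>g\<close> that
  mixes \<open>X\<close> with the image of \<open>s\<close>. In groups \<open>g\<close> and
  \<open>s (c g)\<close> differ by an element of \<open>ker c\<close>; here the connector does the
  work of that quotient. The semidirect product is built from the algebra laws alone, and Barr
  exactness is what makes \<open>X\<close> the kernel of \<open>p\<close>.\<close>

lemma ex1_eq: "\<exists>!h. P h \<Longrightarrow> P x \<Longrightarrow> P y \<Longrightarrow> x = y"
  by blast

locale semi_abelian_category = chosen_limits C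
  for C :: "('o, 'm, 'z) choice_cat_scheme" (structure) +
  assumes semi_abelian: "semi_abelian C"
begin

sublocale category C
  using semi_abelian by (simp add: semi_abelian_def)

abbreviation zero :: "'o \<Rightarrow> 'o \<Rightarrow> 'm" where "zero \<equiv> zero_mor C"
abbreviation ide :: "'o \<Rightarrow> 'm" where "ide \<equiv> Ide C"
abbreviation cop :: "'m \<Rightarrow> 'm \<Rightarrow> 'm" where "cop \<equiv> copair C"
abbreviation pr :: "'m \<Rightarrow> 'm \<Rightarrow> 'm" where "pr \<equiv> pair C"

subsection \<open>Composition, zero morphisms, products and coproducts\<close>

lemma Hom_iff [simp]: "f \<in> Hom C X Y \<longleftrightarrow> f \<in> Ar C \<and> Dom C f = X \<and> Cod C f = Y"
  by (simp add: Hom_def)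

lemma HomD:
  assumes "f \<in> Hom C X Y"
  shows "f \<in> Ar C" "Dom C f = X" "Cod C f = Y" "X \<in> Ob C" "Y \<in> Ob C"
  using assms Dom_Ob Cod_Ob by auto

lemma comp_arr [simp]:
  assumes "f \<in> Ar C" "g \<in> Ar C" "Dom C g = Cod C f"
  shows "g \<cdot> f \<in> Ar C" "Dom C (g \<cdot> f) = Dom C f" "Cod C (g \<cdot> f) = Cod C g"
  using Comp_Hom[of f "Dom C f" "Cod C f" g "Cod C g"] assms by auto

lemma ide_arr [simp]:
  assumes "A \<in> Ob C"
  shows "ide A \<in> Ar C" "Dom C (ide A) = A" "Cod C (ide A) = A"
  using Ide_Hom[OF assms] by auto

lemma comp_ide [simp]:
  assumes "f \<in> Ar C"
  shows "Cod C f = A \<Longrightarrow> ide A \<cdot> f = f" "Dom C f = A \<Longrightarrow> f \<cdot> ide A = f"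
  using Ide_left[of f "Dom C f" "Cod C f"] Ide_right[of f "Dom C f" "Cod C f"] assms by auto

lemma assoc [simp]:
  assumes "f \<in> Ar C" "g \<in> Ar C" "h \<in> Ar C" "Dom C g = Cod C f" "Dom C h = Cod C g"
  shows "(h \<cdot> g) \<cdot> f = h \<cdot> (g \<cdot> f)"
  using Comp_assoc[of f "Dom C f" "Cod C f" g "Cod C g" h "Cod C h"] assms by auto

text \<open>Since \<open>assoc\<close> nests composites to the right, a known equation
  \<open>g \<cdot> f = h\<close> no longer matches inside a longer composite. This is its form with
  a tail \<open>x\<close>.\<close>

lemma reassoc:
  assumes "g \<cdot> f = h" "f \<in> Ar C" "g \<in> Ar C" "Dom C g = Cod C f" "x \<in> Ar C" "Cod C x = Dom C f"
  shows "g \<cdot> (f \<cdot> x) = h \<cdot> x"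
  using assms assoc[of x f g] by auto

lemma zero_object: obtains Z where "is_zero_object C Z"
  using semi_abelian by (auto simp: semi_abelian_def pointed_def)

text \<open>The description in \<open>zero_mor\<close> ranges over all zero objects; the arrow
  \<open>i\<close> between two of them shows that the composite does not depend on the
  choice.\<close>

lemma zero_mor_eq:
  assumes Z: "is_zero_object C Z" and g: "g \<in> Hom C A Z" and h: "h \<in> Hom C Z B"
  shows "zero A B = h \<cdot> g"
  unfolding zero_mor_def
proof (rule the_equality)
  show "\<exists>Z g' h'. is_zero_object C Z \<and> g' \<in> Hom C A Z \<and> h' \<in> Hom C Z B \<and> h \<cdot> g = h' \<cdot> g'"
    using assms by blast
next
  fix f assume "\<exists>Z g' h'. is_zero_object C Z \<and> g' \<in> Hom C A Z \<and> h' \<in> Hom C Z B \<and> f = h' \<cdot> g'"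
  then obtain Z' g' h' where Z': "is_zero_object C Z'" and g': "g' \<in> Hom C A Z'"
    and h': "h' \<in> Hom C Z' B" and f: "f = h' \<cdot> g'" by blast
  have obs: "A \<in> Ob C" "B \<in> Ob C" "Z \<in> Ob C" "Z' \<in> Ob C" using HomD[OF g] HomD[OF h] HomD[OF h'] by auto
  obtain i where i: "i \<in> Hom C Z Z'"
    using Z obs unfolding is_zero_object_def is_initial_def by blast
  have "i \<cdot> g \<in> Hom C A Z'" using i g by auto
  then have 1: "i \<cdot> g = g'"
    using Z' g' obs unfolding is_zero_object_def is_terminal_def by blast
  have "h' \<cdot> i \<in> Hom C Z B" using i h' by auto
  then have 2: "h' \<cdot> i = h"
    using Z h obs unfolding is_zero_object_def is_initial_def by blast
  show "f = h \<cdot> g" unfolding f 1[symmetric] 2[symmetric] using i g h' by auto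
qed

lemma zero_factors:
  assumes "A \<in> Ob C" "B \<in> Ob C" "is_zero_object C Z"
  obtains g h where "g \<in> Hom C A Z" "h \<in> Hom C Z B" "zero A B = h \<cdot> g"
proof -
  obtain g where "g \<in> Hom C A Z"
    using assms unfolding is_zero_object_def is_terminal_def by blast
  moreover obtain h where "h \<in> Hom C Z B"
    using assms unfolding is_zero_object_def is_initial_def by blast
  ultimately show thesis using that zero_mor_eq[OF assms(3)] by blast
qed

lemma zero_arr [simp]:
  assumes "A \<in> Ob C" "B \<in> Ob C"
  shows "zero A B \<in> Ar C" "Dom C (zero A B) = A" "Cod C (zero A B) = B"
proof -
  obtain Z where "is_zero_object C Z" by (rule zero_object)
  from zero_factors[OF assms this] obtain g h where "g \<in> Hom C A Z" "h \<in> Hom C Z B" "zero A B = h \<cdot> g" .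
  then show "zero A B \<in> Ar C" "Dom C (zero A B) = A" "Cod C (zero A B) = B" by auto
qed

lemma comp_zero [simp]:
  assumes f: "f \<in> Ar C" and A: "A \<in> Ob C" and B: "Dom C f = B"
  shows "f \<cdot> zero A B = zero A (Cod C f)"
proof -
  have ob: "B \<in> Ob C" using B Dom_Ob[OF f] by simp
  obtain Z where Z: "is_zero_object C Z" by (rule zero_object)
  from zero_factors[OF A ob Z] obtain g h
    where gh: "g \<in> Hom C A Z" "h \<in> Hom C Z B" "zero A B = h \<cdot> g" .
  have "zero A (Cod C f) = (f \<cdot> h) \<cdot> g" using gh f B by (intro zero_mor_eq[OF Z]) auto
  then show ?thesis using gh f B by auto
qed

lemma zero_comp [simp]:
  assumes f: "f \<in> Ar C" and B: "B \<in> Ob C" and A: "Cod C f = A"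
  shows "zero A B \<cdot> f = zero (Dom C f) B"
proof -
  have ob: "A \<in> Ob C" using A Cod_Ob[OF f] by simp
  obtain Z where Z: "is_zero_object C Z" by (rule zero_object)
  from zero_factors[OF ob B Z] obtain g h
    where gh: "g \<in> Hom C A Z" "h \<in> Hom C Z B" "zero A B = h \<cdot> g" .
  have "zero (Dom C f) B = h \<cdot> (g \<cdot> f)" using gh f A by (intro zero_mor_eq[OF Z]) auto
  then show ?thesis using gh f A by auto
qed

lemma prod_arr [simp]:
  assumes "A \<in> Ob C" "B \<in> Ob C"
  shows "Prod C A B \<in> Ob C"
    "Fst C A B \<in> Ar C" "Dom C (Fst C A B) = Prod C A B" "Cod C (Fst C A B) = A"
    "Snd C A B \<in> Ar C" "Dom C (Snd C A B) = Prod C A B" "Cod C (Snd C A B) = B"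
  using Prod[OF assms] by (auto simp: is_product_def)

lemma coprod_arr [simp]:
  assumes "A \<in> Ob C" "B \<in> Ob C"
  shows "A \<amalg> B \<in> Ob C"
    "In1 C A B \<in> Ar C" "Dom C (In1 C A B) = A" "Cod C (In1 C A B) = A \<amalg> B"
    "In2 C A B \<in> Ar C" "Dom C (In2 C A B) = B" "Cod C (In2 C A B) = A \<amalg> B"
  using Coprod[OF assms] by (auto simp: is_coproduct_def)

lemma pair_ex1:
  assumes "f \<in> Hom C X A" "g \<in> Hom C X B"
  shows "\<exists>!h. h \<in> Hom C X (Prod C A B) \<and> Fst C A B \<cdot> h = f \<and> Snd C A B \<cdot> h = g"
  using Prod[of A B] HomD[OF assms(1)] HomD[OF assms(2)] assms unfolding is_product_def by blast

lemma copair_ex1: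
  assumes "f \<in> Hom C A X" "g \<in> Hom C B X"
  shows "\<exists>!h. h \<in> Hom C (A \<amalg> B) X \<and> h \<cdot> In1 C A B = f \<and> h \<cdot> In2 C A B = g"
  using Coprod[of A B] HomD[OF assms(1)] HomD[OF assms(2)] assms unfolding is_coproduct_def by blast

lemma pair_props:
  assumes f: "f \<in> Ar C" and g: "g \<in> Ar C" and eq: "Dom C f = Dom C g"
  shows "pr f g \<in> Hom C (Dom C f) (Prod C (Cod C f) (Cod C g)) \<and>
    Fst C (Cod C f) (Cod C g) \<cdot> pr f g = f \<and> Snd C (Cod C f) (Cod C g) \<cdot> pr f g = g"
  unfolding pair_def Let_def
  by (rule theI'[OF pair_ex1]) (use assms in auto)

lemma copair_props:
  assumes f: "f \<in> Ar C" and g: "g \<in> Ar C" and eq: "Cod C f = Cod C g"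
  shows "cop f g \<in> Hom C (Dom C f \<amalg> Dom C g) (Cod C f) \<and>
    cop f g \<cdot> In1 C (Dom C f) (Dom C g) = f \<and> cop f g \<cdot> In2 C (Dom C f) (Dom C g) = g"
  unfolding copair_def Let_def
  by (rule theI'[OF copair_ex1]) (use assms in auto)

lemma pair_arr [simp]:
  assumes "f \<in> Ar C" "g \<in> Ar C" "Dom C f = Dom C g"
  shows "pr f g \<in> Ar C" "Dom C (pr f g) = Dom C g" "Cod C (pr f g) = Prod C (Cod C f) (Cod C g)"
    "Cod C f = A \<Longrightarrow> Cod C g = B \<Longrightarrow> Fst C A B \<cdot> pr f g = f"
    "Cod C f = A \<Longrightarrow> Cod C g = B \<Longrightarrow> Snd C A B \<cdot> pr f g = g"
  using pair_props[OF assms] assms by auto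

lemma copair_arr [simp]:
  assumes "f \<in> Ar C" "g \<in> Ar C" "Cod C f = Cod C g"
  shows "cop f g \<in> Ar C" "Dom C (cop f g) = Dom C f \<amalg> Dom C g" "Cod C (cop f g) = Cod C g"
    "Dom C f = A \<Longrightarrow> Dom C g = B \<Longrightarrow> cop f g \<cdot> In1 C A B = f"
    "Dom C f = A \<Longrightarrow> Dom C g = B \<Longrightarrow> cop f g \<cdot> In2 C A B = g"
  using copair_props[OF assms] assms by auto

lemma pair_ext:
  assumes "x \<in> Hom C T (Prod C A B)" "y \<in> Hom C T (Prod C A B)" "A \<in> Ob C" "B \<in> Ob C"
    and "Fst C A B \<cdot> x = Fst C A B \<cdot> y" "Snd C A B \<cdot> x = Snd C A B \<cdot> y"
  shows "x = y"
proof -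
  have h: "Fst C A B \<cdot> x \<in> Hom C T A" "Snd C A B \<cdot> x \<in> Hom C T B" using assms by auto
  show ?thesis
    by (rule ex1_eq[OF pair_ex1[OF h]]) (use assms in simp_all)
qed

lemma copair_ext:
  assumes "x \<in> Hom C (A \<amalg> B) T" "y \<in> Hom C (A \<amalg> B) T" "A \<in> Ob C" "B \<in> Ob C"
    and "x \<cdot> In1 C A B = y \<cdot> In1 C A B" "x \<cdot> In2 C A B = y \<cdot> In2 C A B"
  shows "x = y"
proof -
  have h: "x \<cdot> In1 C A B \<in> Hom C A T" "x \<cdot> In2 C A B \<in> Hom C B T" using assms by auto
  show ?thesis
    by (rule ex1_eq[OF copair_ex1[OF h]]) (use assms in simp_all)
qed

lemma pair_comp_Fst [simp]:
  assumes "f \<in> Ar C" "g \<in> Ar C" "Dom C f = Dom C g" "x \<in> Ar C" "Cod C x = Dom C g"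
    "Cod C f = A" "Cod C g = B"
  shows "Fst C A B \<cdot> (pr f g \<cdot> x) = f \<cdot> x" "Snd C A B \<cdot> (pr f g \<cdot> x) = g \<cdot> x"
proof -
  have "A \<in> Ob C" "B \<in> Ob C" using assms Cod_Ob by blast+
  then show "Fst C A B \<cdot> (pr f g \<cdot> x) = f \<cdot> x" "Snd C A B \<cdot> (pr f g \<cdot> x) = g \<cdot> x"
    using assms by (simp_all add: assoc[symmetric] del: assoc)
qed

lemma pair_comp [simp]:
  assumes "f \<in> Ar C" "g \<in> Ar C" "Dom C f = Dom C g" "x \<in> Ar C" "Cod C x = Dom C g"
  shows "pr f g \<cdot> x = pr (f \<cdot> x) (g \<cdot> x)"
proof -
  have ob: "Cod C f \<in> Ob C" "Cod C g \<in> Ob C" using assms Cod_Ob by blast+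
  show ?thesis
    by (rule pair_ext[of _ "Dom C x" "Cod C f" "Cod C g"]) (use assms ob in simp_all)
qed

text \<open>Normal form for maps out of a coproduct: composition is pushed into the components, so
  that equations are compared summand by summand. The rule is deleted where a composite has to stay
  whole.\<close>

lemma comp_copair [simp]:
  assumes "f \<in> Ar C" "g \<in> Ar C" "Cod C f = Cod C g" "x \<in> Ar C" "Dom C x = Cod C g"
  shows "x \<cdot> cop f g = cop (x \<cdot> f) (x \<cdot> g)"
proof -
  have ob: "Dom C f \<in> Ob C" "Dom C g \<in> Ob C" using assms Dom_Ob by blast+
  show ?thesis
    by (rule copair_ext[of _ "Dom C f" "Dom C g" "Cod C x"]) (use assms ob in simp_all)
qed

lemma copair_comp_In [simp]:
  assumes "f \<in> Ar C" "g \<in> Ar C" "Cod C f = Cod C g" "x \<in> Ar C" "Dom C f = A" "Dom C g = B"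
  shows "Cod C x = A \<Longrightarrow> cop f g \<cdot> (In1 C A B \<cdot> x) = f \<cdot> x"
    "Cod C x = B \<Longrightarrow> cop f g \<cdot> (In2 C A B \<cdot> x) = g \<cdot> x"
proof -
  have "A \<in> Ob C" "B \<in> Ob C" using assms Dom_Ob by blast+
  then show "Cod C x = A \<Longrightarrow> cop f g \<cdot> (In1 C A B \<cdot> x) = f \<cdot> x"
    "Cod C x = B \<Longrightarrow> cop f g \<cdot> (In2 C A B \<cdot> x) = g \<cdot> x"
    using assms by (simp_all add: assoc[symmetric] del: assoc)
qed

lemma comp_copair_comp [simp]:
  assumes "f \<in> Ar C" "g \<in> Ar C" "Cod C f = Cod C g" "x \<in> Ar C" "Dom C x = Cod C g"
    "h \<in> Ar C" "Cod C h = Dom C f \<amalg> Dom C g"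
  shows "x \<cdot> (cop f g \<cdot> h) = cop (x \<cdot> f) (x \<cdot> g) \<cdot> h"
  using assms by (simp add: assoc[symmetric] del: assoc)

lemma copair_In [simp]:
  assumes "A \<in> Ob C" "B \<in> Ob C"
  shows "cop (In1 C A B) (In2 C A B) = ide (A \<amalg> B)"
  by (rule copair_ext[of _ A B "A \<amalg> B"]) (use assms in simp_all)

lemma pair_zero [simp]:
  assumes "A \<in> Ob C" "B \<in> Ob C" "X \<in> Ob C"
  shows "pr (zero X A) (zero X B) = zero X (Prod C A B)"
  by (rule pair_ext[of _ X A B]) (use assms in simp_all)

subsection \<open>Pullbacks, kernels and regular epimorphisms\<close>

lemma barr_exact: "barr_exact C" and protomodular: "protomodular C" and regular_cat: "regular_cat C"
  and finitely_complete: "finitely_complete C"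
  using semi_abelian by (auto simp: semi_abelian_def barr_exact_def regular_cat_def)

lemma pullbackD:
  assumes "is_pullback C P p q f g"
  shows "P \<in> Ob C" "f \<in> Ar C" "g \<in> Ar C" "Cod C f = Cod C g"
    "p \<in> Ar C" "Dom C p = P" "Cod C p = Dom C f" "q \<in> Ar C" "Dom C q = P" "Cod C q = Dom C g"
    "f \<cdot> p = g \<cdot> q"
  using assms by (auto simp: is_pullback_def)

lemma pullback_ex1:
  assumes "is_pullback C P p q f g" "x \<in> Hom C X (Dom C f)" "y \<in> Hom C X (Dom C g)" "f \<cdot> x = g \<cdot> y"
  shows "\<exists>!h. h \<in> Hom C X P \<and> p \<cdot> h = x \<and> q \<cdot> h = y"
  using assms HomD(4)[OF assms(2)] unfolding is_pullback_def by blast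

lemma pullback_lift:
  assumes "is_pullback C P p q f g" "x \<in> Hom C X (Dom C f)" "y \<in> Hom C X (Dom C g)" "f \<cdot> x = g \<cdot> y"
  obtains h where "h \<in> Hom C X P" "p \<cdot> h = x" "q \<cdot> h = y"
  using pullback_ex1[OF assms] by blast

lemma pullback_ext:
  assumes P: "is_pullback C P p q f g" and h: "h \<in> Hom C X P" "h' \<in> Hom C X P"
    and eq: "p \<cdot> h = p \<cdot> h'" "q \<cdot> h = q \<cdot> h'"
  shows "h = h'"
proof -
  note [simp] = pullbackD[OF P]
  have "p \<cdot> h \<in> Hom C X (Dom C f)" "q \<cdot> h \<in> Hom C X (Dom C g)" using h by auto
  moreover have "f \<cdot> (p \<cdot> h) = g \<cdot> (q \<cdot> h)" using h by (simp add: reassoc[OF pullbackD(11)[OF P]])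
  ultimately show ?thesis by (rule ex1_eq[OF pullback_ex1[OF P]]) (use h eq in auto)
qed

lemma pullback_exists:
  assumes f: "f \<in> Ar C" and g: "g \<in> Ar C" and eq: "Cod C f = Cod C g"
  obtains P p q where "is_pullback C P p q f g"
proof -
  let ?A = "Dom C f" and ?B = "Dom C g"
  have [simp]: "?A \<in> Ob C" "?B \<in> Ob C" using f g Dom_Ob by auto
  note [simp] = f g eq
  let ?p = "Fst C ?A ?B" and ?q = "Snd C ?A ?B"
  have "f \<cdot> ?p \<in> Hom C (Prod C ?A ?B) (Cod C f)" "g \<cdot> ?q \<in> Hom C (Prod C ?A ?B) (Cod C f)"
    by auto
  moreover have "Prod C ?A ?B \<in> Ob C" "Cod C f \<in> Ob C" using Cod_Ob by auto
  ultimately obtain E e where E: "is_equalizer C E e (f \<cdot> ?p) (g \<cdot> ?q)"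
    using finitely_complete unfolding finitely_complete_def by blast
  have [simp]: "E \<in> Ob C" "e \<in> Ar C" "Dom C e = E" "Cod C e = Prod C ?A ?B"
    and eqe: "f \<cdot> (?p \<cdot> e) = g \<cdot> (?q \<cdot> e)"
    using E by (auto simp: is_equalizer_def)
  have "is_pullback C E (?p \<cdot> e) (?q \<cdot> e) f g"
    unfolding is_pullback_def
  proof (intro conjI ballI impI)
    fix X x y assume X: "X \<in> Ob C" and x: "x \<in> Hom C X ?A" and y: "y \<in> Hom C X ?B"
      and xy: "f \<cdot> x = g \<cdot> y"
    have "pr x y \<in> Hom C X (Prod C ?A ?B)" "f \<cdot> ?p \<cdot> pr x y = g \<cdot> ?q \<cdot> pr x y"
      using x y xy by auto
    with E X have ex1: "\<exists>!h. h \<in> Hom C X E \<and> e \<cdot> h = pr x y" by (auto simp: is_equalizer_def)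
    then obtain h where h: "h \<in> Hom C X E" "e \<cdot> h = pr x y" by blast
    show "\<exists>!h. h \<in> Hom C X E \<and> ?p \<cdot> e \<cdot> h = x \<and> ?q \<cdot> e \<cdot> h = y"
    proof (rule ex1I[of _ h])
      show "h \<in> Hom C X E \<and> ?p \<cdot> e \<cdot> h = x \<and> ?q \<cdot> e \<cdot> h = y"
        using h x y by auto
    next
      fix h' assume h': "h' \<in> Hom C X E \<and> ?p \<cdot> e \<cdot> h' = x \<and> ?q \<cdot> e \<cdot> h' = y"
      have "e \<cdot> h' = pr x y"
        by (rule pair_ext[of _ X ?A ?B]) (use h' x y in auto)
      with h h' ex1 show "h' = h" by blast
    qed
  qed (auto simp: eqe)
  then show thesis by (rule that)
qed

lemma kerD:
  assumes "is_kernel C K k f"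
  shows "f \<in> Ar C" "K \<in> Ob C" "k \<in> Ar C" "Dom C k = K" "Cod C k = Dom C f" "f \<cdot> k = zero K (Cod C f)"
  using assms Dom_Ob Cod_Ob by (auto simp: is_kernel_def is_equalizer_def)

lemma ker_lift:
  assumes k: "is_kernel C K k f" and x: "x \<in> Hom C X (Dom C f)" and fx: "f \<cdot> x = zero X (Cod C f)"
  obtains h where "h \<in> Hom C X K" "k \<cdot> h = x"
proof -
  note [simp] = kerD[OF k]
  have [simp]: "Cod C f \<in> Ob C" "Dom C f \<in> Ob C" using Cod_Ob Dom_Ob by auto
  have "X \<in> Ob C" using HomD[OF x] by simp
  moreover have "f \<cdot> x = zero (Dom C f) (Cod C f) \<cdot> x" using x fx by auto
  ultimately show thesis using k x that unfolding is_kernel_def is_equalizer_def by blast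
qed

lemma ker_ext:
  assumes k: "is_kernel C K k f" and x: "x \<in> Hom C X K" "y \<in> Hom C X K" and eq: "k \<cdot> x = k \<cdot> y"
  shows "x = y"
proof -
  note [simp] = kerD[OF k]
  have [simp]: "Cod C f \<in> Ob C" "Dom C f \<in> Ob C" using Cod_Ob Dom_Ob by auto
  have "X \<in> Ob C" using HomD[OF x(1)] by simp
  moreover have "k \<cdot> x \<in> Hom C X (Dom C f)" using x by auto
  moreover have "f \<cdot> (k \<cdot> x) = zero (Dom C f) (Cod C f) \<cdot> (k \<cdot> x)"
    using x by (simp add: reassoc[OF kerD(6)[OF k]])
  ultimately have "\<exists>!h. h \<in> Hom C X K \<and> k \<cdot> h = k \<cdot> x"
    using k unfolding is_kernel_def is_equalizer_def by blast
  then show ?thesis by (rule ex1_eq) (use x eq in auto)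
qed

lemma kerI:
  assumes f: "f \<in> Ar C" and k: "k \<in> Hom C K (Dom C f)" and fk: "f \<cdot> k = zero K (Cod C f)"
    and lift: "\<And>X x. x \<in> Hom C X (Dom C f) \<Longrightarrow> f \<cdot> x = zero X (Cod C f) \<Longrightarrow> \<exists>h\<in>Hom C X K. k \<cdot> h = x"
    and mono: "\<And>X x y. x \<in> Hom C X K \<Longrightarrow> y \<in> Hom C X K \<Longrightarrow> k \<cdot> x = k \<cdot> y \<Longrightarrow> x = y"
  shows "is_kernel C K k f"
proof -
  have [simp]: "Cod C f \<in> Ob C" "Dom C f \<in> Ob C" using Cod_Ob Dom_Ob f by auto
  show ?thesis
    unfolding is_kernel_def is_equalizer_def
  proof (intro conjI ballI impI)
    fix X x assume X: "X \<in> Ob C" and x: "x \<in> Hom C X (Dom C f)"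
      and eq: "f \<cdot> x = zero (Dom C f) (Cod C f) \<cdot> x"
    have "f \<cdot> x = zero X (Cod C f)" using eq x by auto
    from lift[OF x this] obtain h where "h \<in> Hom C X K" "k \<cdot> h = x" by blast
    then show "\<exists>!h. h \<in> Hom C X K \<and> k \<cdot> h = x" using mono by blast
  qed (use f k fk HomD[OF k] in auto)
qed

lemma zero_object_ext:
  assumes "is_zero_object C Z" "x \<in> Hom C X Z" "y \<in> Hom C X Z"
  shows "x = y"
  using assms HomD(4)[OF assms(2)] unfolding is_zero_object_def is_terminal_def by blast

text \<open>Makes \<open>protomodular\<close>, which speaks of pullbacks along an arbitrary
  \<open>v\<close>, applicable to kernels: take for \<open>v\<close> the arrow from the zero
  object.\<close>

lemma kernel_pullback:
  assumes k: "is_kernel C K k f" and Z: "is_zero_object C Z"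
  shows "is_pullback C K k (zero K Z) f (zero Z (Cod C f))"
proof -
  note [simp] = kerD[OF k]
  have [simp]: "Cod C f \<in> Ob C" "Dom C f \<in> Ob C" "Z \<in> Ob C"
    using Cod_Ob Dom_Ob Z by (auto simp: is_zero_object_def is_initial_def)
  show ?thesis unfolding is_pullback_def
  proof (intro conjI ballI impI)
    fix X x y assume X: "X \<in> Ob C" and x: "x \<in> Hom C X (Dom C f)"
      and y: "y \<in> Hom C X (Dom C (zero Z (Cod C f)))" and eq: "f \<cdot> x = zero Z (Cod C f) \<cdot> y"
    have "f \<cdot> x = zero X (Cod C f)" using eq y by auto
    from ker_lift[OF k x this] obtain h where h: "h \<in> Hom C X K" "k \<cdot> h = x" .
    have "zero K Z \<cdot> h = y" by (rule zero_object_ext[OF Z]) (use h y X in simp_all)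
    then show "\<exists>!h. h \<in> Hom C X K \<and> k \<cdot> h = x \<and> zero K Z \<cdot> h = y"
      using h ker_ext[OF k] by blast
  qed auto
qed

definition monic :: "'m \<Rightarrow> bool" where
  "monic m \<longleftrightarrow> m \<in> Ar C \<and>
    (\<forall>X. \<forall>x\<in>Hom C X (Dom C m). \<forall>y\<in>Hom C X (Dom C m). m \<cdot> x = m \<cdot> y \<longrightarrow> x = y)"

lemma monicD:
  assumes "monic m" "x \<in> Hom C X (Dom C m)" "y \<in> Hom C X (Dom C m)" "m \<cdot> x = m \<cdot> y"
  shows "x = y"
  using assms unfolding monic_def by blast

lemma isoD:
  assumes "is_iso C f"
  obtains g where "g \<in> Hom C (Cod C f) (Dom C f)" "g \<cdot> f = ide (Dom C f)" "f \<cdot> g = ide (Cod C f)"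
  using assms by (auto simp: is_iso_def)

subsection \<open>Consequences of protomodularity\<close>

lemma pointD:
  assumes "is_point C A p s B"
  shows "A \<in> Ob C" "B \<in> Ob C" "p \<in> Ar C" "Dom C p = A" "Cod C p = B" "s \<in> Ar C" "Dom C s = B" "Cod C s = A"
    "p \<cdot> s = ide B"
  using assms by (auto simp: is_point_def)

text \<open>The split short five lemma. The kernels are \<open>k\<close> and
  \<open>f \<cdot> k\<close> with the same domain, so the arrow that \<open>f\<close> induces
  between them is an identity.\<close>

lemma point_iso:
  assumes pt: "is_point C A p s B" and pt': "is_point C A' p' s' B"
    and f: "f \<in> Hom C A A'" "p' \<cdot> f = p" "f \<cdot> s = s'"
    and k: "is_kernel C K k p" and k': "is_kernel C K (f \<cdot> k) p'"
  shows "is_iso C f"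
proof -
  obtain Z where Z: "is_zero_object C Z" by (rule zero_object)
  note [simp] = pointD[OF pt] pointD[OF pt'] kerD[OF k] kerD[OF k']
  have Zo: "Z \<in> Ob C" using Z by (auto simp: is_zero_object_def is_initial_def)
  have v: "zero Z B \<in> Hom C Z B" using Zo by auto
  have u: "is_pullback C K k (zero K Z) p (zero Z B)" using kernel_pullback[OF k Z] by simp
  have u': "is_pullback C K (f \<cdot> k) (zero K Z) p' (zero Z B)" using kernel_pullback[OF k' Z] by simp
  have g: "ide K \<in> Hom C K K" "(f \<cdot> k) \<cdot> ide K = f \<cdot> k" "zero K Z \<cdot> ide K = zero K Z" "is_iso C (ide K)"
    using f Zo by (auto simp: is_iso_def intro!: bexI[of _ "ide K"])
  show ?thesis
    using protomodular unfolding protomodular_def using v pt pt' f u u' g by blast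
qed

text \<open>A subobject containing the section and the kernel is itself a point over
  \<open>B\<close> with that same kernel, so \<open>point_iso\<close> applies to its
  inclusion.\<close>

lemma jointly_strongly_epic:
  assumes pt: "is_point C P p s B" and k: "is_kernel C K k p"
    and m: "monic m" "m \<in> Hom C M P" and s': "s' \<in> Hom C B M" "m \<cdot> s' = s"
    and k': "k' \<in> Hom C K M" "m \<cdot> k' = k"
  shows "is_iso C m"
proof (rule point_iso[where A = M and p = "p \<cdot> m" and s = s' and k = k' and s' = s])
  note [simp] = pointD[OF pt] kerD[OF k] 
  note [simp] = HomD[OF m(2)] HomD[OF s'(1)] HomD[OF k'(1)] s'(2) k'(2)
  show "is_point C M (p \<cdot> m) s' B" by (auto simp: is_point_def)
  show "is_kernel C K k' (p \<cdot> m)"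
  proof (rule kerI)
    fix X x assume x: "x \<in> Hom C X (Dom C (p \<cdot> m))" "(p \<cdot> m) \<cdot> x = zero X (Cod C (p \<cdot> m))"
    have "m \<cdot> x \<in> Hom C X (Dom C p)" "p \<cdot> (m \<cdot> x) = zero X (Cod C p)" using x by auto
    from ker_lift[OF k this] obtain h where h: "h \<in> Hom C X K" "k \<cdot> h = m \<cdot> x" .
    have "k' \<cdot> h = x"
      by (rule monicD[OF m(1)]) (use h x in \<open>auto simp: reassoc[OF k'(2)]\<close>)
    then show "\<exists>h\<in>Hom C X K. k' \<cdot> h = x" using h by blast
  next
    fix X x y assume xy: "x \<in> Hom C X K" "y \<in> Hom C X K" "k' \<cdot> x = k' \<cdot> y"
    then have "m \<cdot> (k' \<cdot> x) = m \<cdot> (k' \<cdot> y)" by simp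
    then have "k \<cdot> x = k \<cdot> y" using xy(1,2) by (simp add: reassoc[OF k'(2)])
    then show "x = y" using ker_ext[OF k xy(1,2)] by simp
  qed auto
  show "is_kernel C K (m \<cdot> k') p" using k by simp
  show "is_point C P p s B" by fact
qed (use m s' in auto)

text \<open>The equalizer of \<open>f\<close> and \<open>g\<close> is a subobject through which both
  \<open>s\<close> and \<open>k\<close> factor.\<close>

lemma point_ext:
  assumes pt: "is_point C P p s B" and k: "is_kernel C K k p"
    and f: "f \<in> Hom C P Y" and g: "g \<in> Hom C P Y"
    and eq: "f \<cdot> s = g \<cdot> s" "f \<cdot> k = g \<cdot> k"
  shows "f = g"
proof -
  note [simp] = pointD[OF pt] kerD[OF k] HomD[OF f] HomD[OF g]
  obtain E e where E: "is_equalizer C E e f g"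
    using finitely_complete f g unfolding finitely_complete_def
    using pointD(1)[OF pt] HomD(5)[OF f] by blast
  have [simp]: "E \<in> Ob C" "e \<in> Ar C" "Dom C e = E" "Cod C e = P" and fe: "f \<cdot> e = g \<cdot> e"
    using E by (auto simp: is_equalizer_def)
  have un: "\<exists>!h. h \<in> Hom C X E \<and> e \<cdot> h = x" if "x \<in> Hom C X P" "f \<cdot> x = g \<cdot> x" for X x
    using E that HomD(4)[OF that(1)] by (auto simp: is_equalizer_def)
  have e: "monic e" unfolding monic_def
  proof (intro conjI ballI allI impI)
    fix X x y assume xy: "x \<in> Hom C X (Dom C e)" "y \<in> Hom C X (Dom C e)" "e \<cdot> x = e \<cdot> y"
    have "\<exists>!h. h \<in> Hom C X E \<and> e \<cdot> h = e \<cdot> x"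
      by (rule un) (use xy in \<open>auto simp: reassoc[OF fe]\<close>)
    then show "x = y" by (rule ex1_eq) (use xy in auto)
  qed auto
  obtain s' where s': "s' \<in> Hom C B E" "e \<cdot> s' = s" using un[of s B] eq by auto
  obtain k' where k': "k' \<in> Hom C K E" "e \<cdot> k' = k" using un[of k K] eq by auto
  have "is_iso C e"
    by (rule jointly_strongly_epic[OF pt k e _ s' k']) auto
  then obtain e' where e': "e' \<in> Hom C P E" "e \<cdot> e' = ide P" by (auto elim: isoD)
  have "f \<cdot> (e \<cdot> e') = g \<cdot> (e \<cdot> e')" using e'(1) by (simp add: reassoc[OF fe] del: e'(2))
  then show ?thesis using e' by simp
qed

subsection \<open>Regular epimorphisms and images\<close>

lemma regular_epi_factor:
  assumes e: "regular_epi C e" and f: "f \<in> Hom C (Dom C e) Y"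
    and eq: "\<And>T a b. a \<in> Hom C T (Dom C e) \<Longrightarrow> b \<in> Hom C T (Dom C e) \<Longrightarrow> e \<cdot> a = e \<cdot> b \<Longrightarrow> f \<cdot> a = f \<cdot> b"
  obtains h where "h \<in> Hom C (Cod C e) Y" "h \<cdot> e = f"
proof -
  obtain A a b where ab: "a \<in> Hom C A (Dom C e)" "b \<in> Hom C A (Dom C e)"
    and Q: "is_coequalizer C (Cod C e) e a b"
    using e by (auto simp: regular_epi_def)
  have "f \<cdot> a = f \<cdot> b" using Q eq[OF ab] by (simp add: is_coequalizer_def)
  moreover have "f \<in> Hom C (Cod C a) Y" using f ab by simp
  ultimately have "\<exists>!h. h \<in> Hom C (Cod C e) Y \<and> h \<cdot> e = f"
    using Q HomD(5)[OF f] by (simp add: is_coequalizer_def)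
  then show thesis using that by blast
qed

lemma regular_epi_ext:
  assumes e: "regular_epi C e" and x: "x \<in> Hom C (Cod C e) Y" and y: "y \<in> Hom C (Cod C e) Y"
    and eq: "x \<cdot> e = y \<cdot> e"
  shows "x = y"
proof -
  obtain A a b where ab: "a \<in> Hom C A (Dom C e)" "b \<in> Hom C A (Dom C e)"
    and Q: "is_coequalizer C (Cod C e) e a b"
    using e by (auto simp: regular_epi_def)
  have [simp]: "e \<in> Ar C" using e by (simp add: regular_epi_def)
  have ea: "e \<cdot> a = e \<cdot> b" using Q by (simp add: is_coequalizer_def)
  have "(x \<cdot> e) \<cdot> a = (x \<cdot> e) \<cdot> b" using ab x ea by simp
  moreover have "x \<cdot> e \<in> Hom C (Cod C a) Y" using x ab by simp
  ultimately have "\<exists>!h. h \<in> Hom C (Cod C e) Y \<and> h \<cdot> e = x \<cdot> e"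
    using Q HomD(5)[OF x] by (simp add: is_coequalizer_def)
  then show ?thesis by (rule ex1_eq) (use x y eq in auto)
qed

text \<open>The categorical form of "choose a preimage of \<open>x\<close> under \<open>e\<close>":
  one exists after passing to a cover \<open>t\<close>, by stability of regular epimorphisms under
  pullback.\<close>

lemma regular_epi_cover:
  assumes e: "regular_epi C e" and x: "x \<in> Hom C T (Cod C e)"
  obtains T' t b where "regular_epi C t" "t \<in> Hom C T' T" "b \<in> Hom C T' (Dom C e)" "e \<cdot> b = x \<cdot> t"
proof -
  have [simp]: "e \<in> Ar C" using e by (simp add: regular_epi_def)
  obtain P p q where P: "is_pullback C P p q e x"
    using pullback_exists[of e x] x by auto
  have "regular_epi C q" using P e regular_cat unfolding regular_cat_def by blast
  then show thesis by (rule that) (use pullbackD[OF P] x in auto)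
qed

text \<open>Every regular epimorphism is the cokernel of its kernel. The kernel pair of
  \<open>e\<close> is a point split by the diagonal, and the second projection carries its kernel
  into that of \<open>e\<close>; hence \<open>f\<close> equalises the two projections as soon as it
  kills the kernel of \<open>e\<close>.\<close>

lemma regular_epi_coker:
  assumes e: "regular_epi C e" and f: "f \<in> Hom C (Dom C e) Y"
    and ker: "\<And>T x. x \<in> Hom C T (Dom C e) \<Longrightarrow> e \<cdot> x = zero T (Cod C e) \<Longrightarrow> f \<cdot> x = zero T Y"
  obtains h where "h \<in> Hom C (Cod C e) Y" "h \<cdot> e = f"
proof -
  have [simp]: "e \<in> Ar C" using e by (simp add: regular_epi_def)
  note [simp] = HomD[OF f]
  obtain R r1 r2 where R: "is_pullback C R r1 r2 e e" using pullback_exists[of e e] by auto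
  note [simp] = pullbackD(1-3,5-10)[OF R]
  note req = pullbackD(11)[OF R]
  obtain d where d: "d \<in> Hom C (Dom C e) R" "r1 \<cdot> d = ide (Dom C e)" "r2 \<cdot> d = ide (Dom C e)"
    by (rule pullback_lift[OF R, of "ide (Dom C e)" "Dom C e" "ide (Dom C e)"]) auto
  have pt: "is_point C R r1 d (Dom C e)" using d by (auto simp: is_point_def)
  have k: "is_kernel C (Ker C r1) (ker C r1) r1" by (rule Ker) simp
  note [simp] = kerD[OF k]
  have "e \<cdot> (r2 \<cdot> ker C r1) = (e \<cdot> r1) \<cdot> ker C r1" unfolding req by simp
  also have "\<dots> = zero (Ker C r1) (Cod C e)" by simp
  finally have "e \<cdot> (r2 \<cdot> ker C r1) = zero (Ker C r1) (Cod C e)" .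
  then have "f \<cdot> (r2 \<cdot> ker C r1) = zero (Ker C r1) Y" using ker[of "r2 \<cdot> ker C r1"] by simp
  then have fr: "f \<cdot> (r2 \<cdot> ker C r1) = f \<cdot> (r1 \<cdot> ker C r1)" by simp
  have "f \<cdot> r1 = f \<cdot> r2"
    by (rule point_ext[OF pt k, where Y = Y]) (use d fr in auto)
  show thesis
  proof (rule regular_epi_factor[OF e f])
    fix T a b assume ab: "a \<in> Hom C T (Dom C e)" "b \<in> Hom C T (Dom C e)" "e \<cdot> a = e \<cdot> b"
    from pullback_lift[OF R this] obtain h where h: "h \<in> Hom C T R" "r1 \<cdot> h = a" "r2 \<cdot> h = b" .
    have "f \<cdot> (r1 \<cdot> h) = f \<cdot> (r2 \<cdot> h)"
      using h(1) by (simp add: reassoc[OF \<open>f \<cdot> r1 = f \<cdot> r2\<close>])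
    then show "f \<cdot> a = f \<cdot> b" using h by simp
  qed (rule that)
qed

text \<open>Take \<open>e\<close> to be the coequalizer of the kernel pair of \<open>f\<close>. To
  see that \<open>m\<close> is monic, two elements identified by \<open>m\<close> are lifted to
  \<open>X\<close> on a common cover; the lifts are identified by \<open>f\<close>, so they form an
  element of the kernel pair, and \<open>e\<close> identifies them.\<close>

lemma image_factorization:
  assumes f: "f \<in> Hom C X Y"
  obtains I e m where "regular_epi C e" "e \<in> Hom C X I" "m \<in> Hom C I Y" "monic m" "m \<cdot> e = f"
proof -
  note [simp] = HomD[OF f]
  obtain R r1 r2 where R: "is_pullback C R r1 r2 f f" using pullback_exists[of f f] by auto
  note [simp] = pullbackD(1-3,5-10)[OF R]
  obtain I e where Q: "is_coequalizer C I e r1 r2"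
    using R regular_cat unfolding regular_cat_def kernel_pair_def by blast
  have [simp]: "I \<in> Ob C" "e \<in> Ar C" "Dom C e = X" "Cod C e = I" and er: "e \<cdot> r1 = e \<cdot> r2"
    using Q by (auto simp: is_coequalizer_def)
  have e: "regular_epi C e"
    unfolding regular_epi_def using Q by (intro conjI exI[of _ R] exI[of _ r1] exI[of _ r2]) simp_all
  have fr: "f \<cdot> r1 = f \<cdot> r2" by (rule pullbackD[OF R])
  have "f \<in> Hom C (Cod C r1) Y" by simp
  then obtain m where m: "m \<in> Hom C I Y" "m \<cdot> e = f"
    using Q fr HomD(5)[OF f] unfolding is_coequalizer_def by blast
  note [simp] = HomD[OF m(1)]
  have "monic m" unfolding monic_def
  proof (intro conjI allI ballI impI)
    fix T x y assume x: "x \<in> Hom C T (Dom C m)" and y: "y \<in> Hom C T (Dom C m)" and eq: "m \<cdot> x = m \<cdot> y"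
    obtain T1 t1 b1 where 1: "regular_epi C t1" "t1 \<in> Hom C T1 T" "b1 \<in> Hom C T1 X" "e \<cdot> b1 = x \<cdot> t1"
      using regular_epi_cover[OF e, of x T] x by auto
    obtain T2 t2 b2 where 2: "regular_epi C t2" "t2 \<in> Hom C T2 T1" "b2 \<in> Hom C T2 X" "e \<cdot> b2 = (y \<cdot> t1) \<cdot> t2"
      using regular_epi_cover[OF e, of "y \<cdot> t1" T1] y 1 by auto
    note [simp] = HomD[OF 1(2)] HomD[OF 1(3)] HomD[OF 2(2)] HomD[OF 2(3)] HomD[OF x, simplified] HomD[OF y, simplified]
    have "f \<cdot> (b1 \<cdot> t2) = m \<cdot> ((e \<cdot> b1) \<cdot> t2)" unfolding m(2)[symmetric] by simp
    also have "\<dots> = (m \<cdot> x) \<cdot> (t1 \<cdot> t2)" unfolding 1(4) by simp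
    also have "\<dots> = m \<cdot> (e \<cdot> b2)" unfolding eq 2(4) by simp
    also have "\<dots> = f \<cdot> b2" unfolding m(2)[symmetric] by simp
    finally have fb: "f \<cdot> (b1 \<cdot> t2) = f \<cdot> b2" .
    obtain h where h: "h \<in> Hom C T2 R" "r1 \<cdot> h = b1 \<cdot> t2" "r2 \<cdot> h = b2"
      by (rule pullback_lift[OF R _ _ fb]) auto
    have "e \<cdot> (r1 \<cdot> h) = e \<cdot> (r2 \<cdot> h)" using h(1) by (simp add: reassoc[OF er])
    then have "(e \<cdot> b1) \<cdot> t2 = e \<cdot> b2" using h by simp
    then have "(x \<cdot> t1) \<cdot> t2 = (y \<cdot> t1) \<cdot> t2" unfolding 1(4) 2(4) .
    then have "x \<cdot> t1 = y \<cdot> t1" using regular_epi_ext[OF 2(1), of "x \<cdot> t1" I "y \<cdot> t1"] by simp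
    then show "x = y" using regular_epi_ext[OF 1(1), of x I y] by simp
  qed simp
  then show thesis using that[OF e _ m(1) _ m(2)] by auto
qed

text \<open>The image of \<open>[s, k] : B + K \<rightarrow> P\<close> contains the section and the
  kernel, so it is all of \<open>P\<close>. Thus \<open>[s, k]\<close> is a cokernel, and
  \<open>[u, v]\<close> descends along it once it kills the same elements.\<close>

lemma point_extension:
  assumes pt: "is_point C P p s B" and k: "is_kernel C K k p"
    and u: "u \<in> Hom C B Y" and v: "v \<in> Hom C K Y"
    and ker: "\<And>T h. h \<in> Hom C T (B \<amalg> K) \<Longrightarrow> cop s k \<cdot> h = zero T P \<Longrightarrow> cop u v \<cdot> h = zero T Y"
  obtains \<phi> where "\<phi> \<in> Hom C P Y" "\<phi> \<cdot> s = u" "\<phi> \<cdot> k = v"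
proof -
  note [simp] = pointD[OF pt] kerD[OF k] HomD[OF u] HomD[OF v]
  have "cop s k \<in> Hom C (B \<amalg> K) P" by simp
  from image_factorization[OF this] obtain I e m
    where e: "regular_epi C e" "e \<in> Hom C (B \<amalg> K) I" and m: "m \<in> Hom C I P" "monic m"
      and me: "m \<cdot> e = cop s k" .
  note [simp] = HomD[OF e(2)] HomD[OF m(1)]
  have s: "e \<cdot> In1 C B K \<in> Hom C B I" "m \<cdot> (e \<cdot> In1 C B K) = s"
    and k': "e \<cdot> In2 C B K \<in> Hom C K I" "m \<cdot> (e \<cdot> In2 C B K) = k"
    by (auto simp: reassoc[OF me])
  have "is_iso C m" by (rule jointly_strongly_epic[OF pt k m(2,1) s k'])
  then obtain m' where m': "m' \<in> Hom C P I" "m' \<cdot> m = ide I" by (auto elim: isoD)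
  obtain h where h: "h \<in> Hom C I Y" "h \<cdot> e = cop u v"
  proof (rule regular_epi_coker[OF e(1), of "cop u v" Y])
    fix T x assume x: "x \<in> Hom C T (Dom C e)" "e \<cdot> x = zero T (Cod C e)"
    have "cop s k \<cdot> x = m \<cdot> (e \<cdot> x)" unfolding me[symmetric] using x(1) by simp
    also have "\<dots> = zero T P" using x HomD[OF x(1)] by simp
    finally show "cop u v \<cdot> x = zero T Y" using ker[of x T] x by simp
  qed (use that in auto)
  have e': "m' \<cdot> cop s k = e" unfolding me[symmetric] using m' by (simp add: reassoc[OF m'(2)])
  have "m' \<cdot> s = e \<cdot> In1 C B K" "m' \<cdot> k = e \<cdot> In2 C B K" unfolding e'[symmetric] using m'(1) by simp_all
  then have "(h \<cdot> m') \<cdot> s = u" "(h \<cdot> m') \<cdot> k = v"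
    using h(1) m'(1) by (simp_all add: reassoc[OF h(2)])
  then show thesis using that[of "h \<cdot> m'"] h(1) m'(1) by auto
qed

subsection \<open>Reflexive relations\<close>

lemma pair_eqD:
  assumes "pr f g \<cdot> x = pr f' g' \<cdot> y" "f \<in> Hom C X A" "g \<in> Hom C X B" "f' \<in> Hom C Y A" "g' \<in> Hom C Y B"
    "x \<in> Hom C T X" "y \<in> Hom C T Y"
  shows "f \<cdot> x = f' \<cdot> y" "g \<cdot> x = g' \<cdot> y"
proof -
  note [simp] = HomD[OF assms(2)] HomD[OF assms(3)] HomD[OF assms(4)] HomD[OF assms(5)]
    HomD[OF assms(6)] HomD[OF assms(7)]
  have "Fst C A B \<cdot> (pr f g \<cdot> x) = Fst C A B \<cdot> (pr f' g' \<cdot> y)"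
    "Snd C A B \<cdot> (pr f g \<cdot> x) = Snd C A B \<cdot> (pr f' g' \<cdot> y)" using assms(1) by simp_all
  then show "f \<cdot> x = f' \<cdot> y" "g \<cdot> x = g' \<cdot> y" by simp_all
qed

text \<open>Writing \<open>xRy\<close> for the relation, the pullback \<open>P\<close> below consists of the chains \<open>xRy\<close>, \<open>zRy\<close>, \<open>zRw\<close>. The
  chains with \<open>xRw\<close> form a subobject through which both injections into \<open>P\<close> factor, so they are all of \<open>P\<close>.\<close>

lemma reflexive_relation_difunctional:
  assumes r1: "r1 \<in> Hom C R X" and r2: "r2 \<in> Hom C R X"
    and jm: "\<And>T x y. x \<in> Hom C T R \<Longrightarrow> y \<in> Hom C T R \<Longrightarrow> r1 \<cdot> x = r1 \<cdot> y \<Longrightarrow> r2 \<cdot> x = r2 \<cdot> y \<Longrightarrow> x = y"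
    and \<rho>: "\<rho> \<in> Hom C T R" and \<sigma>: "\<sigma> \<in> Hom C T R" and \<tau>: "\<tau> \<in> Hom C T R"
    and eq: "r2 \<cdot> \<rho> = r2 \<cdot> \<sigma>" "r1 \<cdot> \<sigma> = r1 \<cdot> \<tau>"
  obtains \<theta> where "\<theta> \<in> Hom C T R" "r1 \<cdot> \<theta> = r1 \<cdot> \<rho>" "r2 \<cdot> \<theta> = r2 \<cdot> \<tau>"
proof -
  note [simp] = HomD[OF r1] HomD[OF r2]
  obtain E1 p1 p2 where E1: "is_pullback C E1 p1 p2 r2 r2" using pullback_exists[of r2 r2] by auto
  obtain E2 q1 q2 where E2: "is_pullback C E2 q1 q2 r1 r1" using pullback_exists[of r1 r1] by auto
  note [simp] = pullbackD(1-3,5-10)[OF E1] pullbackD(1-3,5-10)[OF E2]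
  note pe = pullbackD(11)[OF E1] and qe = pullbackD(11)[OF E2]
  have "p2 \<in> Ar C" "q1 \<in> Ar C" "Cod C p2 = Cod C q1" by simp_all
  from pullback_exists[OF this] obtain P \<pi>1 \<pi>2 where P: "is_pullback C P \<pi>1 \<pi>2 p2 q1" .
  note [simp] = pullbackD(1-10)[OF P] and \<pi>e = pullbackD(11)[OF P]
  obtain d1 where d1: "d1 \<in> Hom C R E1" "p1 \<cdot> d1 = ide R" "p2 \<cdot> d1 = ide R"
    by (rule pullback_lift[OF E1, of "ide R" R "ide R"]) auto
  obtain d2 where d2: "d2 \<in> Hom C R E2" "q1 \<cdot> d2 = ide R" "q2 \<cdot> d2 = ide R"
    by (rule pullback_lift[OF E2, of "ide R" R "ide R"]) auto
  note [simp] = HomD[OF d1(1)] HomD[OF d2(1)] d1(2,3) d2(2,3)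
    reassoc[OF d1(2)] reassoc[OF d1(3)] reassoc[OF d2(2)] reassoc[OF d2(3)]
  \<comment> \<open>In elements, with a chain written as a triple of members of \<open>R\<close>:
    \<open>a\<close> sends (\<rho>, \<sigma>) to (\<rho>, \<sigma>, \<sigma>) and \<open>b\<close>
    sends (\<sigma>, \<tau>) to (\<sigma>, \<sigma>, \<tau>).\<close>
  obtain a where a: "a \<in> Hom C E1 P" "\<pi>1 \<cdot> a = ide E1" "\<pi>2 \<cdot> a = d2 \<cdot> p2"
    by (rule pullback_lift[OF P, of "ide E1" E1 "d2 \<cdot> p2"]) auto
  obtain b where b: "b \<in> Hom C E2 P" "\<pi>1 \<cdot> b = d1 \<cdot> q1" "\<pi>2 \<cdot> b = ide E2"
    by (rule pullback_lift[OF P, of "d1 \<cdot> q1" E2 "ide E2"]) auto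
  note [simp] = HomD[OF a(1)] HomD[OF b(1)] a(2,3) b(2,3)
    reassoc[OF a(2)] reassoc[OF a(3)] reassoc[OF b(2)] reassoc[OF b(3)]
  let ?k = "ker C q1" and ?K = "Ker C q1"
  have k: "is_kernel C ?K ?k q1" by (rule Ker) simp
  note [simp] = kerD[OF k] reassoc[OF kerD(6)[OF k]]
  have pt: "is_point C P \<pi>1 a E1" by (simp add: is_point_def)
  have kb: "is_kernel C ?K (b \<cdot> ?k) \<pi>1"
  proof (rule kerI)
    fix S x assume x: "x \<in> Hom C S (Dom C \<pi>1)" and "\<pi>1 \<cdot> x = zero S (Cod C \<pi>1)"
    then have x0: "\<pi>1 \<cdot> x = zero S E1" by simp
    note [simp] = HomD[OF x, simplified]
    have "q1 \<cdot> (\<pi>2 \<cdot> x) = (p2 \<cdot> \<pi>1) \<cdot> x" unfolding \<pi>e by simp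
    also have "\<dots> = zero S R" by (simp add: x0)
    finally have q0: "q1 \<cdot> (\<pi>2 \<cdot> x) = zero S (Cod C q1)" by simp
    with k obtain h where h: "h \<in> Hom C S ?K" "?k \<cdot> h = \<pi>2 \<cdot> x"
      using ker_lift[of ?K ?k q1 "\<pi>2 \<cdot> x" S] by auto
    note [simp] = HomD[OF h(1)]
    have "(b \<cdot> ?k) \<cdot> h = x"
      by (rule pullback_ext[OF P, where X = S]) (simp_all add: x0 q0 h(2))
    then show "\<exists>h\<in>Hom C S ?K. (b \<cdot> ?k) \<cdot> h = x" using h(1) by blast
  next
    fix S x y assume xy: "x \<in> Hom C S ?K" "y \<in> Hom C S ?K" "(b \<cdot> ?k) \<cdot> x = (b \<cdot> ?k) \<cdot> y"
    note [simp] = HomD[OF xy(1)] HomD[OF xy(2)]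
    from xy(3) have "\<pi>2 \<cdot> ((b \<cdot> ?k) \<cdot> x) = \<pi>2 \<cdot> ((b \<cdot> ?k) \<cdot> y)" by (rule arg_cong)
    then have "?k \<cdot> x = ?k \<cdot> y" by simp
    then show "x = y" by (rule ker_ext[OF k xy(1,2)])
  qed simp_all
  \<comment> \<open>\<open>M\<close> is the subobject of chains whose two ends are related, with
    \<open>n\<close> the member of \<open>R\<close> relating them. On \<open>a\<close> that member
    is \<rho> (the lift \<open>p1\<close>), on \<open>b\<close> it is \<tau> (the lift
    \<open>q2\<close>).\<close>
  let ?r = "pr r1 r2" and ?s = "pr (r1 \<cdot> (p1 \<cdot> \<pi>1)) (r2 \<cdot> (q2 \<cdot> \<pi>2))"
  have "?r \<in> Ar C" "?s \<in> Ar C" "Cod C ?r = Cod C ?s" by simp_all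
  from pullback_exists[OF this] obtain M n m where M: "is_pullback C M n m ?r ?s" .
  have [simp]: "M \<in> Ob C" "n \<in> Ar C" "Dom C n = M" "Cod C n = R" "m \<in> Ar C" "Dom C m = M" "Cod C m = P"
    using pullbackD[OF M] by simp_all
  have nm: "?r \<cdot> n = ?s \<cdot> m" by (rule pullbackD(11)[OF M])
  have n1: "r1 \<cdot> n = (r1 \<cdot> (p1 \<cdot> \<pi>1)) \<cdot> m" "r2 \<cdot> n = (r2 \<cdot> (q2 \<cdot> \<pi>2)) \<cdot> m"
    by (rule pair_eqD[OF nm]; simp)+
  have m: "monic m" unfolding monic_def
  proof (intro conjI allI ballI impI)
    fix S x y assume x: "x \<in> Hom C S (Dom C m)" and y: "y \<in> Hom C S (Dom C m)" and eq: "m \<cdot> x = m \<cdot> y"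
    note [simp] = HomD[OF x, simplified] HomD[OF y, simplified]
    have "n \<cdot> x = n \<cdot> y"
      by (rule jm[where T = S]) (simp_all add: reassoc[OF n1(1)] reassoc[OF n1(2)] eq)
    then show "x = y" using eq x y pullback_ext[OF M, of x S y] by simp
  qed simp
  obtain a' where a': "a' \<in> Hom C E1 M" "m \<cdot> a' = a"
    by (rule pullback_lift[OF M, of p1 E1 a]) (simp_all add: pe)
  have "?r \<cdot> q2 = ?s \<cdot> b" by (simp add: qe)
  then obtain b' where b': "b' \<in> Hom C E2 M" "m \<cdot> b' = b"
    using pullback_lift[OF M, of q2 E2 b] by auto
  note [simp] = HomD[OF a'(1)] HomD[OF b'(1)]
  have "is_iso C m"
    by (rule jointly_strongly_epic[OF pt kb m _ a', where k' = "b' \<cdot> ?k"]) (simp_all add: reassoc[OF b'(2)])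
  then obtain m' where m': "m' \<in> Hom C P M" "m \<cdot> m' = ide P" by (auto elim: isoD)
  note [simp] = HomD[OF m'(1)] m'(2) reassoc[OF m'(2)] HomD[OF \<rho>] HomD[OF \<sigma>] HomD[OF \<tau>]
  obtain t1 where t1: "t1 \<in> Hom C T E1" "p1 \<cdot> t1 = \<rho>" "p2 \<cdot> t1 = \<sigma>"
    by (rule pullback_lift[OF E1, of \<rho> T \<sigma>]) (simp_all add: eq)
  obtain t2 where t2: "t2 \<in> Hom C T E2" "q1 \<cdot> t2 = \<sigma>" "q2 \<cdot> t2 = \<tau>"
    by (rule pullback_lift[OF E2, of \<sigma> T \<tau>]) (simp_all add: eq)
  note [simp] = HomD[OF t1(1)] HomD[OF t2(1)] t1(2,3) t2(2,3)
  obtain t where t: "t \<in> Hom C T P" "\<pi>1 \<cdot> t = t1" "\<pi>2 \<cdot> t = t2"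
    by (rule pullback_lift[OF P, of t1 T t2]) simp_all
  note [simp] = HomD[OF t(1)] t(2,3)
  have "n \<cdot> (m' \<cdot> t) \<in> Hom C T R" by simp
  moreover have "r1 \<cdot> (n \<cdot> (m' \<cdot> t)) = r1 \<cdot> \<rho>" "r2 \<cdot> (n \<cdot> (m' \<cdot> t)) = r2 \<cdot> \<tau>"
    by (simp_all add: reassoc[OF n1(1)] reassoc[OF n1(2)])
  ultimately show thesis by (rule that)
qed

text \<open>Difunctionality with reflexive links inserted: the chain yRy, xRy, xRx gives yRx, and
  the chain xRy, yRy, yRz gives xRz.\<close>

lemma reflexive_relation_equivalence:
  assumes r1: "r1 \<in> Hom C R X" and r2: "r2 \<in> Hom C R X"
    and jm: "\<And>T x y. x \<in> Hom C T R \<Longrightarrow> y \<in> Hom C T R \<Longrightarrow> r1 \<cdot> x = r1 \<cdot> y \<Longrightarrow> r2 \<cdot> x = r2 \<cdot> y \<Longrightarrow> x = y"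
    and d: "d \<in> Hom C X R" "r1 \<cdot> d = ide X" "r2 \<cdot> d = ide X"
  shows "equivalence_relation C R r1 r2 X"
  unfolding equivalence_relation_def
proof (intro conjI ballI allI impI)
  note [simp] = HomD[OF r1] HomD[OF r2] HomD[OF d(1)] d(2,3) reassoc[OF d(2)] reassoc[OF d(3)]
  show "\<exists>d\<in>Hom C X R. r1 \<cdot> d = ide X \<and> r2 \<cdot> d = ide X" using d by blast
  obtain s where "s \<in> Hom C R R" "r1 \<cdot> s = r1 \<cdot> (d \<cdot> r2)" "r2 \<cdot> s = r2 \<cdot> (d \<cdot> r1)"
    by (rule reflexive_relation_difunctional[OF r1 r2 jm, where T = R and \<rho> = "d \<cdot> r2" and \<sigma> = "ide R" and \<tau> = "d \<cdot> r1"]) simp_all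
  then show "\<exists>s\<in>Hom C R R. r1 \<cdot> s = r2 \<and> r2 \<cdot> s = r1" by auto
  fix P p q assume P: "is_pullback C P p q r2 r1"
  have [simp]: "P \<in> Ob C" "p \<in> Ar C" "Dom C p = P" "Cod C p = R" "q \<in> Ar C" "Dom C q = P" "Cod C q = R"
    using pullbackD[OF P] by simp_all
  note pq = pullbackD(11)[OF P]
  obtain t where "t \<in> Hom C P R" "r1 \<cdot> t = r1 \<cdot> p" "r2 \<cdot> t = r2 \<cdot> q"
    by (rule reflexive_relation_difunctional[OF r1 r2 jm, where T = P and \<rho> = p and \<sigma> = "d \<cdot> (r2 \<cdot> p)" and \<tau> = q]) (simp_all add: pq)
  then show "\<exists>t\<in>Hom C P R. r1 \<cdot> t = r1 \<cdot> p \<and> r2 \<cdot> t = r2 \<cdot> q" by blast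
qed (use r1 r2 jm HomD[OF r1] in auto)

text \<open>A reflexive graph may have parallel edges, so it is replaced by its image in
  \<open>D \<times> D\<close>. That image is a relation with diagonal
  \<open>e \<cdot> \<sigma>\<close>, hence an equivalence relation, and \<open>e\<close> lifts its
  members to edges locally.\<close>

lemma reflexive_graph_image:
  assumes u: "u \<in> Hom C B D" and v: "v \<in> Hom C B D"
    and \<sigma>: "\<sigma> \<in> Hom C D B" "u \<cdot> \<sigma> = ide D" "v \<cdot> \<sigma> = ide D"
  obtains R e r1 r2 where "regular_epi C e" "e \<in> Hom C B R" "r1 \<cdot> e = u" "r2 \<cdot> e = v"
    "equivalence_relation C R r1 r2 D"
proof -
  note [simp] = HomD[OF u] HomD[OF v] HomD[OF \<sigma>(1)] \<sigma>(2,3)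
  have "pr u v \<in> Hom C B (Prod C D D)" by simp
  from image_factorization[OF this] obtain R e m where e: "regular_epi C e" "e \<in> Hom C B R"
    and m: "m \<in> Hom C R (Prod C D D)" "monic m" and me: "m \<cdot> e = pr u v" .
  note [simp] = HomD[OF e(2)] HomD[OF m(1)] me reassoc[OF me]
  let ?r1 = "Fst C D D \<cdot> m" and ?r2 = "Snd C D D \<cdot> m"
  have "equivalence_relation C R ?r1 ?r2 D"
  proof (rule reflexive_relation_equivalence[where d = "e \<cdot> \<sigma>"])
    fix T x y assume x: "x \<in> Hom C T R" and y: "y \<in> Hom C T R"
      and eq: "?r1 \<cdot> x = ?r1 \<cdot> y" "?r2 \<cdot> x = ?r2 \<cdot> y"
    note [simp] = HomD[OF x] HomD[OF y]
    have "m \<cdot> x = m \<cdot> y" by (rule pair_ext[of _ T D D]) (use eq in simp_all)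
    then show "x = y" using monicD[OF m(2), of x T y] by simp
  qed simp_all
  then show thesis by (intro that[OF e]) simp_all
qed

subsection \<open>The functor \<open>\<flat>\<close> and internal actions\<close>

abbreviation fl :: "'o \<Rightarrow> 'o \<Rightarrow> 'o" where "fl \<equiv> flat C"
abbreviation fk :: "'o \<Rightarrow> 'o \<Rightarrow> 'm" where "fk \<equiv> flat_ker C"
abbreviation fm :: "'m \<Rightarrow> 'm \<Rightarrow> 'm" where "fm \<equiv> flat_map C"

lemma flat_kernel:
  assumes "A \<in> Ob C" "B \<in> Ob C"
  shows "is_kernel C (fl A B) (fk A B) (cop (ide A) (zero B A))"
  unfolding flat_def flat_ker_def by (rule Ker) (use assms in simp)

lemma flat_arr [simp]:
  assumes "A \<in> Ob C" "B \<in> Ob C"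
  shows "fl A B \<in> Ob C" "fk A B \<in> Ar C" "Dom C (fk A B) = fl A B" "Cod C (fk A B) = A \<amalg> B"
  using kerD[OF flat_kernel[OF assms]] assms by simp_all

lemma copair_zero_flat_ker [simp]:
  assumes "a \<in> Ar C" "B \<in> Ob C" "Dom C a = A" "Cod C a = A'"
  shows "cop a (zero B A') \<cdot> fk A B = zero (fl A B) A'"
    "x \<in> Ar C \<Longrightarrow> Cod C x = fl A B \<Longrightarrow> cop a (zero B A') \<cdot> (fk A B \<cdot> x) = zero (Dom C x) A'"
proof -
  have [simp]: "A \<in> Ob C" "A' \<in> Ob C" using assms Dom_Ob Cod_Ob by blast+
  note [simp] = assms
  have "cop a (zero B A') = a \<cdot> cop (ide A) (zero B A)" by simp
  then have "cop a (zero B A') \<cdot> fk A B = a \<cdot> (cop (ide A) (zero B A) \<cdot> fk A B)" by (simp del: comp_copair comp_copair_comp)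
  also have "\<dots> = zero (fl A B) A'" using kerD(6)[OF flat_kernel, of A B] by (simp del: comp_copair comp_copair_comp)
  finally show *: "cop a (zero B A') \<cdot> fk A B = zero (fl A B) A'" .
  show "x \<in> Ar C \<Longrightarrow> Cod C x = fl A B \<Longrightarrow> cop a (zero B A') \<cdot> (fk A B \<cdot> x) = zero (Dom C x) A'"
    by (simp add: reassoc[OF *])
qed

lemma flat_lift:
  assumes "h \<in> Hom C T (A \<amalg> B)" "cop (ide A) (zero B A) \<cdot> h = zero T A" "A \<in> Ob C" "B \<in> Ob C"
  obtains h' where "h' \<in> Hom C T (fl A B)" "fk A B \<cdot> h' = h"
  by (rule ker_lift[OF flat_kernel[OF assms(3,4)], of h T]) (use assms in simp_all)

lemma flat_ext:
  assumes "x \<in> Hom C T (fl A B)" "y \<in> Hom C T (fl A B)" "fk A B \<cdot> x = fk A B \<cdot> y" "A \<in> Ob C" "B \<in> Ob C"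
  shows "x = y"
  by (rule ker_ext[OF flat_kernel[OF assms(4,5)] assms(1,2,3)])

lemma flat_the:
  assumes h: "h \<in> Hom C T (A \<amalg> B)" "cop (ide A) (zero B A) \<cdot> h = zero T A" "A \<in> Ob C" "B \<in> Ob C"
  shows "(THE h'. h' \<in> Hom C T (fl A B) \<and> fk A B \<cdot> h' = h) \<in> Hom C T (fl A B) \<and>
    fk A B \<cdot> (THE h'. h' \<in> Hom C T (fl A B) \<and> fk A B \<cdot> h' = h) = h"
proof -
  obtain h' where h': "h' \<in> Hom C T (fl A B)" "fk A B \<cdot> h' = h" by (rule flat_lift[OF assms])
  have "\<exists>!h'. h' \<in> Hom C T (fl A B) \<and> fk A B \<cdot> h' = h"
  proof (rule ex1I)
    show "h' \<in> Hom C T (fl A B) \<and> fk A B \<cdot> h' = h" using h' by blast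
  next
    fix y assume y: "y \<in> Hom C T (fl A B) \<and> fk A B \<cdot> y = h"
    show "y = h'" by (rule flat_ext[OF _ h'(1) _ assms(3,4)]) (use y h' in simp_all)
  qed
  then show ?thesis by (rule theI')
qed

lemma coprod_map_arr [simp]:
  assumes "f \<in> Ar C" "g \<in> Ar C"
  shows "coprod_map C f g \<in> Ar C" "Dom C (coprod_map C f g) = Dom C f \<amalg> Dom C g"
    "Cod C (coprod_map C f g) = Cod C f \<amalg> Cod C g"
  using assms Cod_Ob by (simp_all add: coprod_map_def)

lemma copair_coprod_map [simp]:
  assumes "f \<in> Ar C" "g \<in> Ar C" "a \<in> Ar C" "b \<in> Ar C" "Cod C a = Cod C b" "Dom C a = Cod C f" "Dom C b = Cod C g"
  shows "cop a b \<cdot> coprod_map C f g = cop (a \<cdot> f) (b \<cdot> g)"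
    "x \<in> Ar C \<Longrightarrow> Cod C x = Dom C f \<amalg> Dom C g \<Longrightarrow> cop a b \<cdot> (coprod_map C f g \<cdot> x) = cop (a \<cdot> f) (b \<cdot> g) \<cdot> x"
  using assms Cod_Ob by (simp_all add: coprod_map_def)

lemma flat_map_arr [simp]:
  assumes "f \<in> Ar C" "g \<in> Ar C"
  shows "fm f g \<in> Ar C" "Dom C (fm f g) = fl (Dom C f) (Dom C g)" "Cod C (fm f g) = fl (Cod C f) (Cod C g)"
    "Cod C f = A \<Longrightarrow> Cod C g = B \<Longrightarrow> fk A B \<cdot> fm f g = coprod_map C f g \<cdot> fk (Dom C f) (Dom C g)"
    "Cod C f = A \<Longrightarrow> Cod C g = B \<Longrightarrow> x \<in> Ar C \<Longrightarrow> Cod C x = fl (Dom C f) (Dom C g) \<Longrightarrow>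
      fk A B \<cdot> (fm f g \<cdot> x) = coprod_map C f g \<cdot> (fk (Dom C f) (Dom C g) \<cdot> x)"
proof -
  have [simp]: "Dom C f \<in> Ob C" "Dom C g \<in> Ob C" "Cod C f \<in> Ob C" "Cod C g \<in> Ob C"
    using assms Dom_Ob Cod_Ob by blast+
  note [simp] = assms
  have *: "fm f g \<in> Hom C (fl (Dom C f) (Dom C g)) (fl (Cod C f) (Cod C g)) \<and>
    fk (Cod C f) (Cod C g) \<cdot> fm f g = coprod_map C f g \<cdot> fk (Dom C f) (Dom C g)"
    unfolding flat_map_def by (rule flat_the) simp_all
  then show **: "fm f g \<in> Ar C" "Dom C (fm f g) = fl (Dom C f) (Dom C g)" "Cod C (fm f g) = fl (Cod C f) (Cod C g)"
    by simp_all
  show "Cod C f = A \<Longrightarrow> Cod C g = B \<Longrightarrow> fk A B \<cdot> fm f g = coprod_map C f g \<cdot> fk (Dom C f) (Dom C g)"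
    using * by simp
  show "Cod C f = A \<Longrightarrow> Cod C g = B \<Longrightarrow> x \<in> Ar C \<Longrightarrow> Cod C x = fl (Dom C f) (Dom C g) \<Longrightarrow>
      fk A B \<cdot> (fm f g \<cdot> x) = coprod_map C f g \<cdot> (fk (Dom C f) (Dom C g) \<cdot> x)"
    using reassoc[OF conjunct2[OF *], of x] ** by auto
qed

lemma flat_unit_arr [simp]:
  assumes "A \<in> Ob C" "B \<in> Ob C"
  shows "flat_unit C A B \<in> Ar C" "Dom C (flat_unit C A B) = B" "Cod C (flat_unit C A B) = fl A B"
    "fk A B \<cdot> flat_unit C A B = In2 C A B"
    "x \<in> Ar C \<Longrightarrow> Cod C x = B \<Longrightarrow> fk A B \<cdot> (flat_unit C A B \<cdot> x) = In2 C A B \<cdot> x"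
proof -
  have *: "flat_unit C A B \<in> Hom C B (fl A B) \<and> fk A B \<cdot> flat_unit C A B = In2 C A B"
    unfolding flat_unit_def by (rule flat_the) (use assms in simp_all)
  then show **: "flat_unit C A B \<in> Ar C" "Dom C (flat_unit C A B) = B" "Cod C (flat_unit C A B) = fl A B"
    "fk A B \<cdot> flat_unit C A B = In2 C A B" by simp_all
  show "x \<in> Ar C \<Longrightarrow> Cod C x = B \<Longrightarrow> fk A B \<cdot> (flat_unit C A B \<cdot> x) = In2 C A B \<cdot> x"
    using assms ** by (simp add: assoc[symmetric] del: assoc)
qed

lemma flat_mult_arr [simp]:
  assumes "A \<in> Ob C" "B \<in> Ob C"
  shows "flat_mult C A B \<in> Ar C" "Dom C (flat_mult C A B) = fl A (fl A B)" "Cod C (flat_mult C A B) = fl A B"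
    "fk A B \<cdot> flat_mult C A B = cop (In1 C A B) (fk A B) \<cdot> fk A (fl A B)"
    "x \<in> Ar C \<Longrightarrow> Cod C x = fl A (fl A B) \<Longrightarrow>
      fk A B \<cdot> (flat_mult C A B \<cdot> x) = cop (In1 C A B) (fk A B) \<cdot> (fk A (fl A B) \<cdot> x)"
proof -
  have *: "flat_mult C A B \<in> Hom C (fl A (fl A B)) (fl A B) \<and>
    fk A B \<cdot> flat_mult C A B = cop (In1 C A B) (fk A B) \<cdot> fk A (fl A B)"
    unfolding flat_mult_def by (rule flat_the) (use assms in simp_all)
  then show **: "flat_mult C A B \<in> Ar C" "Dom C (flat_mult C A B) = fl A (fl A B)" "Cod C (flat_mult C A B) = fl A B"
    "fk A B \<cdot> flat_mult C A B = cop (In1 C A B) (fk A B) \<cdot> fk A (fl A B)" by simp_all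
  show "x \<in> Ar C \<Longrightarrow> Cod C x = fl A (fl A B) \<Longrightarrow>
      fk A B \<cdot> (flat_mult C A B \<cdot> x) = cop (In1 C A B) (fk A B) \<cdot> (fk A (fl A B) \<cdot> x)"
    using reassoc[OF **(4), of x] assms ** by simp
qed

lemma flat_map_comp:
  assumes "f \<in> Ar C" "g \<in> Ar C" "f' \<in> Ar C" "g' \<in> Ar C" "Dom C f = Cod C f'" "Dom C g = Cod C g'"
  shows "fm f g \<cdot> fm f' g' = fm (f \<cdot> f') (g \<cdot> g')"
proof -
  have [simp]: "Dom C f' \<in> Ob C" "Dom C g' \<in> Ob C" "Cod C f \<in> Ob C" "Cod C g \<in> Ob C"
    "Cod C f' \<in> Ob C" "Cod C g' \<in> Ob C"
    using assms Dom_Ob Cod_Ob by blast+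
  note [simp] = assms
  show ?thesis
    by (rule flat_ext[where T = "fl (Dom C f') (Dom C g')" and A = "Cod C f" and B = "Cod C g"])
      (simp_all add: coprod_map_def)
qed

lemma actionD:
  assumes "internal_action C A X \<xi>"
  shows "A \<in> Ob C" "X \<in> Ob C" "\<xi> \<in> Ar C" "Dom C \<xi> = fl A X" "Cod C \<xi> = X"
    "\<xi> \<cdot> flat_unit C A X = ide X" "\<xi> \<cdot> flat_mult C A X = \<xi> \<cdot> fm (ide A) \<xi>"
  using assms by (auto simp: internal_action_def)

text \<open>\<open>fm f (ide X)\<close> respects the units (\<open>u\<close>) and the
  multiplications (\<open>m\<close>) of the two monads, so algebra structures restrict along
  it.\<close>

lemma internal_action_pullback:
  assumes act: "internal_action C A X \<xi>" and f: "f \<in> Hom C B A"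
  shows "internal_action C B X (\<xi> \<cdot> fm f (ide X))"
proof -
  note [simp] = actionD(1-5)[OF act] HomD[OF f]
  note unit = actionD(6)[OF act] and mult = actionD(7)[OF act]
  have u: "fm f (ide X) \<cdot> flat_unit C B X = flat_unit C A X"
    by (rule flat_ext[where T = X and A = A and B = X]) (simp_all add: coprod_map_def)
  have m: "fm f (ide X) \<cdot> flat_mult C B X = flat_mult C A X \<cdot> fm f (fm f (ide X))"
    by (rule flat_ext[where T = "fl B (fl B X)" and A = A and B = X]) (simp_all add: coprod_map_def)
  have "(\<xi> \<cdot> fm f (ide X)) \<cdot> flat_mult C B X = (\<xi> \<cdot> flat_mult C A X) \<cdot> fm f (fm f (ide X))"
    by (simp add: m)
  also have "\<dots> = \<xi> \<cdot> (fm (ide A) \<xi> \<cdot> fm f (fm f (ide X)))" unfolding mult by simp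
  also have "\<dots> = \<xi> \<cdot> (fm f (ide X) \<cdot> fm (ide B) (\<xi> \<cdot> fm f (ide X)))"
    by (simp add: flat_map_comp)
  finally show ?thesis by (simp add: internal_action_def u unit)
qed

subsection \<open>Semidirect products\<close>

text \<open>The last clause says that elements identified by \<open>q\<close> are locally joined by
  a single edge, with no zigzags. This is exactness: the image relation is the kernel pair of some
  \<open>f0\<close>, and \<open>f0\<close> factors through \<open>q\<close>, so
  \<open>q \<cdot> x = q \<cdot> y\<close> puts the pair (x, y) into the relation, which
  \<open>B\<close> covers.\<close>

lemma reflexive_graph_coequalizer:
  assumes u: "u \<in> Hom C B D" and v: "v \<in> Hom C B D"
    and \<sigma>: "\<sigma> \<in> Hom C D B" "u \<cdot> \<sigma> = ide D" "v \<cdot> \<sigma> = ide D"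
  obtains G q where "regular_epi C q" "q \<in> Hom C D G" "q \<cdot> u = q \<cdot> v"
    "\<And>Y f. f \<in> Hom C D Y \<Longrightarrow> f \<cdot> u = f \<cdot> v \<Longrightarrow> \<exists>h\<in>Hom C G Y. h \<cdot> q = f"
    "\<And>T x y. x \<in> Hom C T D \<Longrightarrow> y \<in> Hom C T D \<Longrightarrow> q \<cdot> x = q \<cdot> y \<Longrightarrow>
      \<exists>T' t b. regular_epi C t \<and> t \<in> Hom C T' T \<and> b \<in> Hom C T' B \<and> u \<cdot> b = x \<cdot> t \<and> v \<cdot> b = y \<cdot> t"
proof -
  note [simp] = HomD[OF u] HomD[OF v]
  obtain R e r1 r2 where e: "regular_epi C e" "e \<in> Hom C B R" and re: "r1 \<cdot> e = u" "r2 \<cdot> e = v"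
    and R: "equivalence_relation C R r1 r2 D"
    by (rule reflexive_graph_image[OF u v \<sigma>])
  have [simp]: "R \<in> Ob C" "r1 \<in> Ar C" "Dom C r1 = R" "Cod C r1 = D" "r2 \<in> Ar C" "Dom C r2 = R" "Cod C r2 = D"
    using R by (auto simp: equivalence_relation_def)
  note [simp] = HomD[OF e(2)]
  obtain f0 where "kernel_pair C R r1 r2 f0"
    using R barr_exact unfolding barr_exact_def by blast
  then have f0: "is_pullback C R r1 r2 f0 f0" by (simp add: kernel_pair_def)
  have [simp]: "f0 \<in> Ar C" "Dom C f0 = D" using pullbackD(2,7)[OF f0] by auto
  have f0r: "f0 \<cdot> r1 = f0 \<cdot> r2" by (rule pullbackD[OF f0])
  obtain G q where Q: "is_coequalizer C G q r1 r2"
    using f0 regular_cat unfolding regular_cat_def kernel_pair_def by blast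
  have [simp]: "G \<in> Ob C" "q \<in> Ar C" "Dom C q = D" "Cod C q = G" and qr: "q \<cdot> r1 = q \<cdot> r2"
    using Q by (auto simp: is_coequalizer_def)
  have q: "regular_epi C q"
    unfolding regular_epi_def using Q by (intro conjI exI[of _ R] exI[of _ r1] exI[of _ r2]) simp_all
  have coeq: "\<exists>h\<in>Hom C G Y. h \<cdot> q = f" if f: "f \<in> Hom C D Y" and fr: "f \<cdot> r1 = f \<cdot> r2" for f Y
  proof -
    have "f \<in> Hom C (Cod C r1) Y" using f by simp
    then show ?thesis using Q HomD(5)[OF f] fr unfolding is_coequalizer_def by blast
  qed
  show thesis
  proof (rule that[OF q])
    show "q \<cdot> u = q \<cdot> v" unfolding re[symmetric] by (simp add: reassoc[OF qr])
  next
    fix Y f assume f: "f \<in> Hom C D Y" and eq: "f \<cdot> u = f \<cdot> v"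
    note [simp] = HomD[OF f]
    have "(f \<cdot> r1) \<cdot> e = (f \<cdot> r2) \<cdot> e" by (simp add: re eq)
    then have "f \<cdot> r1 = f \<cdot> r2" using regular_epi_ext[OF e(1), of "f \<cdot> r1" Y "f \<cdot> r2"] by simp
    then show "\<exists>h\<in>Hom C G Y. h \<cdot> q = f" by (rule coeq[OF f])
  next
    fix T x y assume x: "x \<in> Hom C T D" and y: "y \<in> Hom C T D" and eq: "q \<cdot> x = q \<cdot> y"
    note [simp] = HomD[OF x] HomD[OF y]
    have "f0 \<in> Hom C D (Cod C f0)" by simp
    from coeq[OF this f0r] obtain g where g: "g \<in> Hom C G (Cod C f0)" "g \<cdot> q = f0" by blast
    have fxy: "f0 \<cdot> x = f0 \<cdot> y" unfolding g(2)[symmetric] using g(1) eq by simp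
    obtain h where h: "h \<in> Hom C T R" "r1 \<cdot> h = x" "r2 \<cdot> h = y"
      by (rule pullback_lift[OF f0 _ _ fxy]) simp_all
    note [simp] = HomD[OF h(1)]
    obtain T' t b where t: "regular_epi C t" "t \<in> Hom C T' T" "b \<in> Hom C T' B" "e \<cdot> b = h \<cdot> t"
      using regular_epi_cover[OF e(1), of h T] by auto
    note [simp] = HomD[OF t(2)] HomD[OF t(3)]
    have "u \<cdot> b = x \<cdot> t" "v \<cdot> b = y \<cdot> t" unfolding re[symmetric] h(2,3)[symmetric] by (simp_all add: t(4))
    then show "\<exists>T' t b. regular_epi C t \<and> t \<in> Hom C T' T \<and> b \<in> Hom C T' B \<and> u \<cdot> b = x \<cdot> t \<and> v \<cdot> b = y \<cdot> t"
      using t by blast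
  qed simp_all
qed

text \<open>The semidirect product is the coequalizer of \<open>[i\<^sub>A, k], 1 + \<xi> : A + (A \<flat> X) \<rightarrow> A + X\<close>, which has the
  common section \<open>1 + \<eta>\<close>.\<close>

lemma semidirect_product:
  assumes act: "internal_action C A X \<xi>"
  obtains G p s \<kappa> where "is_point C G p s A" "is_kernel C X \<kappa> p" "cop s \<kappa> \<cdot> fk A X = \<kappa> \<cdot> \<xi>"
    "\<And>Y f g. f \<in> Hom C A Y \<Longrightarrow> g \<in> Hom C X Y \<Longrightarrow> cop f g \<cdot> fk A X = g \<cdot> \<xi> \<Longrightarrow>
      \<exists>h\<in>Hom C G Y. h \<cdot> s = f \<and> h \<cdot> \<kappa> = g"
proof -
  note [simp] = actionD(1-5)[OF act]
  note unit = actionD(6)[OF act] and mult = actionD(7)[OF act]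
  let ?B = "A \<amalg> fl A X" and ?D = "A \<amalg> X"
  let ?u = "cop (In1 C A X) (fk A X)" and ?v = "coprod_map C (ide A) \<xi>"
    and ?w = "coprod_map C (ide A) (flat_unit C A X)"
  have uv: "?u \<in> Hom C ?B ?D" "?v \<in> Hom C ?B ?D" "?w \<in> Hom C ?D ?B" "?u \<cdot> ?w = ide ?D" "?v \<cdot> ?w = ide ?D"
    by (simp_all add: coprod_map_def unit)
  obtain G q where q: "regular_epi C q" "q \<in> Hom C ?D G" "q \<cdot> ?u = q \<cdot> ?v"
    and coeq: "\<And>Y f. f \<in> Hom C ?D Y \<Longrightarrow> f \<cdot> ?u = f \<cdot> ?v \<Longrightarrow> \<exists>h\<in>Hom C G Y. h \<cdot> q = f"
    and cover: "\<And>T x y. x \<in> Hom C T ?D \<Longrightarrow> y \<in> Hom C T ?D \<Longrightarrow> q \<cdot> x = q \<cdot> y \<Longrightarrow>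
      \<exists>T' t b. regular_epi C t \<and> t \<in> Hom C T' T \<and> b \<in> Hom C T' ?B \<and> ?u \<cdot> b = x \<cdot> t \<and> ?v \<cdot> b = y \<cdot> t"
    by (rule reflexive_graph_coequalizer[OF uv]) blast
  note [simp] = HomD[OF q(2)]
  let ?p0 = "cop (ide A) (zero X A)"
  let ?s = "q \<cdot> In1 C A X" and ?\<kappa> = "q \<cdot> In2 C A X"
  obtain p where p: "p \<in> Hom C G A" "p \<cdot> q = ?p0"
    using coeq[of ?p0 A] by (auto simp: coprod_map_def)
  note [simp] = HomD[OF p(1)] p(2) reassoc[OF p(2)]
  have q_eq: "cop ?s ?\<kappa> = q" by (rule copair_ext[of _ A X G]) simp_all
  have qk: "q \<cdot> fk A X = ?\<kappa> \<cdot> \<xi>"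
  proof -
    have "q \<cdot> fk A X = (q \<cdot> ?u) \<cdot> In2 C A (fl A X)" by simp
    also have "\<dots> = ?\<kappa> \<cdot> \<xi>" unfolding q(3) by (simp add: coprod_map_def)
    finally show ?thesis .
  qed
  \<comment> \<open>Elements of \<open>X\<close> identified in \<open>G\<close> are locally joined
    by one edge \<open>b\<close> of \<open>A + (A \<flat> X)\<close>. Its \<open>A\<close>-part is
    zero, so it comes from \<open>A \<flat> (A \<flat> X)\<close>. There its two ends are computed
    by the multiplication and by \<open>1 \<flat> \<xi>\<close>, which \<xi> identifies by the
    algebra law.\<close>
  have \<kappa>_mono: "x = y" if x: "x \<in> Hom C T X" and y: "y \<in> Hom C T X" and eq: "?\<kappa> \<cdot> x = ?\<kappa> \<cdot> y" for T x y
  proof -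
    note [simp] = HomD[OF x] HomD[OF y]
    obtain T' t b where t: "regular_epi C t" "t \<in> Hom C T' T" "b \<in> Hom C T' ?B"
      and b: "?u \<cdot> b = (In2 C A X \<cdot> x) \<cdot> t" "?v \<cdot> b = (In2 C A X \<cdot> y) \<cdot> t"
      using cover[of "In2 C A X \<cdot> x" T "In2 C A X \<cdot> y"] eq by auto
    note [simp] = HomD[OF t(2)] HomD[OF t(3)]
    have "cop (ide A) (zero (fl A X) A) \<cdot> b = ?p0 \<cdot> (?u \<cdot> b)" by simp
    also have "\<dots> = zero T' A" unfolding b by simp
    finally obtain b' where b': "b' \<in> Hom C T' (fl A (fl A X))" "fk A (fl A X) \<cdot> b' = b"
      using flat_lift[of b T' A "fl A X"] by auto
    note [simp] = HomD[OF b'(1)] b'(2)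
    have 1: "flat_mult C A X \<cdot> b' = flat_unit C A X \<cdot> (x \<cdot> t)"
      by (rule flat_ext[where T = T' and A = A and B = X]) (use b(1) in simp_all)
    have 2: "fm (ide A) \<xi> \<cdot> b' = flat_unit C A X \<cdot> (y \<cdot> t)"
      by (rule flat_ext[where T = T' and A = A and B = X]) (use b(2) in simp_all)
    have "x \<cdot> t = \<xi> \<cdot> (flat_unit C A X \<cdot> (x \<cdot> t))" by (simp add: reassoc[OF unit])
    also have "\<dots> = \<xi> \<cdot> (fm (ide A) \<xi> \<cdot> b')" unfolding 1[symmetric] by (simp add: reassoc[OF mult])
    also have "\<dots> = y \<cdot> t" unfolding 2 by (simp add: reassoc[OF unit])
    finally show "x = y" using regular_epi_ext[OF t(1), of x X y] by simp
  qed
  \<comment> \<open>An element of the kernel of \<open>p\<close> lifts locally to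
    \<open>A + X\<close>; the lift lies in \<open>A \<flat> X\<close>, so \<xi> turns it into an
    element of \<open>X\<close> with the right image. This local solution descends along the cover
    because the injection of \<open>X\<close> is monic.\<close>
  have ker: "is_kernel C X ?\<kappa> p"
  proof (rule kerI)
    fix T x assume x: "x \<in> Hom C T (Dom C p)" and px: "p \<cdot> x = zero T (Cod C p)"
    note [simp] = HomD[OF x, simplified]
    obtain T' t b where t: "regular_epi C t" "t \<in> Hom C T' T" "b \<in> Hom C T' ?D" "q \<cdot> b = x \<cdot> t"
      using regular_epi_cover[OF q(1), of x T] by auto
    note [simp] = HomD[OF t(2)] HomD[OF t(3)]
    have "?p0 \<cdot> b = (p \<cdot> x) \<cdot> t" unfolding p(2)[symmetric] by (simp add: t(4) del: p(2) reassoc[OF p(2)])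
    also have "\<dots> = zero T' A" unfolding px by simp
    finally obtain b' where b': "b' \<in> Hom C T' (fl A X)" "fk A X \<cdot> b' = b"
      using flat_lift[of b T' A X] by auto
    note [simp] = HomD[OF b'(1)]
    let ?y = "\<xi> \<cdot> b'"
    have y: "?\<kappa> \<cdot> ?y = x \<cdot> t"
      unfolding t(4)[symmetric] b'(2)[symmetric] by (simp add: reassoc[OF qk])
    obtain h where h: "h \<in> Hom C T X" "h \<cdot> t = ?y"
    proof (rule regular_epi_factor[OF t(1), of ?y X])
      fix S a c assume a: "a \<in> Hom C S (Dom C t)" and c: "c \<in> Hom C S (Dom C t)" and eq: "t \<cdot> a = t \<cdot> c"
      note [simp] = HomD[OF a, simplified] HomD[OF c, simplified]
      have "(?\<kappa> \<cdot> ?y) \<cdot> a = (?\<kappa> \<cdot> ?y) \<cdot> c" unfolding y using eq by simp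
      then show "?y \<cdot> a = ?y \<cdot> c" using \<kappa>_mono[of "?y \<cdot> a" S "?y \<cdot> c"] by simp
    qed (use that in auto)
    note [simp] = HomD[OF h(1)]
    have "(?\<kappa> \<cdot> h) \<cdot> t = x \<cdot> t" using y by (simp add: h(2))
    then have "?\<kappa> \<cdot> h = x" using regular_epi_ext[OF t(1), of "?\<kappa> \<cdot> h" G x] by simp
    then show "\<exists>h\<in>Hom C T X. ?\<kappa> \<cdot> h = x" using h(1) by blast
  qed (use \<kappa>_mono in simp_all)
  show thesis
  proof (rule that[OF _ ker])
    show "is_point C G p ?s A" by (simp add: is_point_def)
    show "cop ?s ?\<kappa> \<cdot> fk A X = ?\<kappa> \<cdot> \<xi>" unfolding q_eq by (rule qk)
  next
    fix Y f g assume f: "f \<in> Hom C A Y" and g: "g \<in> Hom C X Y" and eq: "cop f g \<cdot> fk A X = g \<cdot> \<xi>"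
    note [simp] = HomD[OF f] HomD[OF g]
    obtain h where h: "h \<in> Hom C G Y" "h \<cdot> q = cop f g"
      using coeq[of "cop f g" Y] by (auto simp: eq coprod_map_def)
    then show "\<exists>h\<in>Hom C G Y. h \<cdot> ?s = f \<and> h \<cdot> ?\<kappa> = g"
      by (intro bexI[of _ h]) (simp_all add: reassoc[OF h(2)])
  qed
qed

subsection \<open>Commuting normal subobjects\<close>

lemma prod_kernel:
  assumes "A \<in> Ob C" "B \<in> Ob C"
  shows "is_kernel C B (pr (zero B A) (ide B)) (Fst C A B)"
proof (rule kerI)
  note [simp] = assms
  fix T x assume x: "x \<in> Hom C T (Dom C (Fst C A B))" and eq: "Fst C A B \<cdot> x = zero T (Cod C (Fst C A B))"
  note [simp] = HomD[OF x, simplified]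
  have "pr (zero B A) (ide B) \<cdot> (Snd C A B \<cdot> x) = x"
    by (rule pair_ext[of _ T A B]) (use eq in simp_all)
  then show "\<exists>h\<in>Hom C T B. pr (zero B A) (ide B) \<cdot> h = x" by (intro bexI[of _ "Snd C A B \<cdot> x"]) simp_all
next
  note [simp] = assms
  fix T x y assume x: "x \<in> Hom C T B" and y: "y \<in> Hom C T B"
    and eq: "pr (zero B A) (ide B) \<cdot> x = pr (zero B A) (ide B) \<cdot> y"
  note [simp] = HomD[OF x] HomD[OF y]
  have "Snd C A B \<cdot> (pr (zero B A) (ide B) \<cdot> x) = Snd C A B \<cdot> (pr (zero B A) (ide B) \<cdot> y)"
    using eq by (rule arg_cong)
  then show "x = y" by (simp del: pair_comp)
qed (use assms in simp_all)

text \<open>Two sections are used later: the diagonal, for the division map, and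
  \<open>(1, 0)\<close>, for commuting pairs.\<close>

lemma prod_point:
  assumes "f \<in> Hom C A B"
  shows "is_point C (Prod C A B) (Fst C A B) (pr (ide A) f) A"
  using assms HomD[OF assms] by (simp add: is_point_def)

text \<open>\<open>1 \<times> t\<close> is the pullback of \<open>t\<close> along the second
  projection.\<close>

lemma regular_epi_prod:
  assumes t: "regular_epi C t" "t \<in> Hom C T K" and X: "X \<in> Ob C"
  shows "regular_epi C (pr (Fst C X T) (t \<cdot> Snd C X T))"
proof -
  note [simp] = HomD[OF t(2)] X
  have "is_pullback C (Prod C X T) (Snd C X T) (pr (Fst C X T) (t \<cdot> Snd C X T)) t (Snd C X K)"
    unfolding is_pullback_def
  proof (intro conjI ballI impI)
    fix S x y assume x: "x \<in> Hom C S (Dom C t)" and y: "y \<in> Hom C S (Dom C (Snd C X K))"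
      and eq: "t \<cdot> x = Snd C X K \<cdot> y"
    note [simp] = HomD[OF x, simplified] HomD[OF y, simplified]
    let ?h = "pr (Fst C X K \<cdot> y) x"
    show "\<exists>!h. h \<in> Hom C S (Prod C X T) \<and> Snd C X T \<cdot> h = x \<and> pr (Fst C X T) (t \<cdot> Snd C X T) \<cdot> h = y"
    proof (rule ex1I[of _ ?h])
      have "pr (Fst C X T) (t \<cdot> Snd C X T) \<cdot> ?h = y"
        by (rule pair_ext[of _ S X K]) (simp_all add: eq)
      then show "?h \<in> Hom C S (Prod C X T) \<and> Snd C X T \<cdot> ?h = x \<and> pr (Fst C X T) (t \<cdot> Snd C X T) \<cdot> ?h = y"
        by simp
    next
      fix h assume h: "h \<in> Hom C S (Prod C X T) \<and> Snd C X T \<cdot> h = x \<and> pr (Fst C X T) (t \<cdot> Snd C X T) \<cdot> h = y"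
      then have [simp]: "h \<in> Ar C" "Dom C h = S" "Cod C h = Prod C X T" by simp_all
      have y': "y = pr (Fst C X T) (t \<cdot> Snd C X T) \<cdot> h" using h by blast
      have "Fst C X T \<cdot> h = Fst C X K \<cdot> y" unfolding y' by simp
      then show "h = ?h" using h pair_ext[of h S X T ?h] by simp
    qed
  qed simp_all
  then show ?thesis using t(1) regular_cat unfolding regular_cat_def by blast
qed

lemma huq_commuteI:
  assumes \<phi>: "\<phi> \<in> Hom C (Prod C K L) X"
    and k: "\<phi> \<cdot> pr (ide K) (zero K L) = k" and l: "\<phi> \<cdot> pr (zero L K) (ide L) = l"
    and ob: "K \<in> Ob C" "L \<in> Ob C"
  shows "huq_commute C K k L l X"
  unfolding huq_commute_def
proof (intro conjI exI)
  note [simp] = HomD[OF \<phi>] ob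
  show "is_product C (Prod C K L) (Fst C K L) (Snd C K L) K L" by (rule Prod) simp_all
  show "k \<in> Hom C K X" "l \<in> Hom C L X" unfolding k[symmetric] l[symmetric] by simp_all
qed (use \<phi> k l ob in simp_all)

text \<open>Commuting with \<open>l\<close> may be tested on a cover of \<open>L\<close>. The kernel
  of \<open>1 \<times> t\<close> consists of pairs (0, z) with \<open>t z = 0\<close>; there \<phi>
  takes the value \<open>l t z = 0\<close>, so it descends along
  \<open>1 \<times> t\<close>.\<close>

lemma huq_commute_cover:
  assumes t: "regular_epi C t" "t \<in> Hom C T L" and l: "l \<in> Hom C L X" and K: "K \<in> Ob C"
    and \<phi>: "\<phi> \<in> Hom C (Prod C K T) X" "\<phi> \<cdot> pr (ide K) (zero K T) = k" "\<phi> \<cdot> pr (zero T K) (ide T) = l \<cdot> t"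
  shows "huq_commute C K k L l X"
proof -
  note [simp] = HomD[OF t(2)] HomD[OF l] K HomD[OF \<phi>(1)]
  let ?e = "pr (Fst C K T) (t \<cdot> Snd C K T)"
  have e: "regular_epi C ?e" by (rule regular_epi_prod[OF t K])
  obtain \<psi> where \<psi>: "\<psi> \<in> Hom C (Prod C K L) X" "\<psi> \<cdot> ?e = \<phi>"
  proof (rule regular_epi_coker[OF e, of \<phi> X])
    fix S x assume x: "x \<in> Hom C S (Dom C ?e)" and ex: "?e \<cdot> x = zero S (Cod C ?e)"
    note [simp] = HomD[OF x, simplified]
    have "Fst C K L \<cdot> (?e \<cdot> x) = zero S K" "Snd C K L \<cdot> (?e \<cdot> x) = zero S L"
      unfolding ex by simp_all
    then have x0: "Fst C K T \<cdot> x = zero S K" "t \<cdot> (Snd C K T \<cdot> x) = zero S L" by simp_all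
    have "x = pr (zero T K) (ide T) \<cdot> (Snd C K T \<cdot> x)"
      by (rule pair_ext[of _ S K T]) (simp_all add: x0(1))
    then have "\<phi> \<cdot> x = (\<phi> \<cdot> pr (zero T K) (ide T)) \<cdot> (Snd C K T \<cdot> x)" by (simp del: pair_comp)
    also have "\<dots> = zero S X" unfolding \<phi>(3) by (simp add: x0(2))
    finally show "\<phi> \<cdot> x = zero S X" .
  qed (use that in simp_all)
  note [simp] = HomD[OF \<psi>(1)]
  show ?thesis
  proof (rule huq_commuteI[OF \<psi>(1)])
    have "\<psi> \<cdot> pr (ide K) (zero K L) = (\<psi> \<cdot> ?e) \<cdot> pr (ide K) (zero K T)" by simp
    also have "\<dots> = k" unfolding \<psi>(2) by (rule \<phi>(2))
    finally show "\<psi> \<cdot> pr (ide K) (zero K L) = k" .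
    have "(\<psi> \<cdot> pr (zero L K) (ide L)) \<cdot> t = (\<psi> \<cdot> ?e) \<cdot> pr (zero T K) (ide T)" by simp
    also have "\<dots> = l \<cdot> t" unfolding \<psi>(2) by (rule \<phi>(3))
    finally show "\<psi> \<cdot> pr (zero L K) (ide L) = l"
      using regular_epi_ext[OF t(1), of "\<psi> \<cdot> pr (zero L K) (ide L)" X l] by simp
  qed simp_all
qed

section \<open>Kernel pairs as equivalence relations, and their normalisations\<close>

lemma kernel_pair_equivalence:
  assumes R: "is_pullback C R r1 r2 f f"
  shows "equivalence_relation C R r1 r2 (Dom C f)"
proof -
  note [simp] = pullbackD(1-3,5-10)[OF R]
  have [simp]: "Dom C f \<in> Ob C" using Dom_Ob by simp
  obtain d where d: "d \<in> Hom C (Dom C f) R" "r1 \<cdot> d = ide (Dom C f)" "r2 \<cdot> d = ide (Dom C f)"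
    by (rule pullback_lift[OF R, of "ide (Dom C f)" "Dom C f" "ide (Dom C f)"]) simp_all
  show ?thesis
    by (rule reflexive_relation_equivalence[OF _ _ _ d]) (use pullback_ext[OF R] in simp_all)
qed

text \<open>The kernel of the first projection is the pair \<open>(0, k)\<close>, whose second
  component is \<open>k\<close>.\<close>

lemma kernel_pair_normalisation:
  assumes R: "is_pullback C R r1 r2 f f" and k: "is_kernel C K k f"
  shows "normalisation C K k R r1 r2"
proof -
  note [simp] = pullbackD(1-3,5-10)[OF R] kerD[OF k]
  note fr = pullbackD(11)[OF R]
  have [simp]: "Dom C f \<in> Ob C" "Cod C f \<in> Ob C" using Dom_Ob Cod_Ob by simp_all
  obtain n where n: "n \<in> Hom C K R" "r1 \<cdot> n = zero K (Dom C f)" "r2 \<cdot> n = k"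
    by (rule pullback_lift[OF R, of "zero K (Dom C f)" K k]) simp_all
  note [simp] = HomD[OF n(1)] n(2,3) reassoc[OF n(2)] reassoc[OF n(3)]
  have "is_kernel C K n r1"
  proof (rule kerI)
    fix T x assume x: "x \<in> Hom C T (Dom C r1)" and "r1 \<cdot> x = zero T (Cod C r1)"
    then have x0: "r1 \<cdot> x = zero T (Dom C f)" by simp
    note [simp] = HomD[OF x, simplified]
    have "f \<cdot> (r2 \<cdot> x) = (f \<cdot> r1) \<cdot> x" unfolding fr by simp
    also have "\<dots> = zero T (Cod C f)" by (simp add: x0)
    finally obtain h where h: "h \<in> Hom C T K" "k \<cdot> h = r2 \<cdot> x"
      using ker_lift[OF k, of "r2 \<cdot> x" T] by auto
    note [simp] = HomD[OF h(1)]
    have "n \<cdot> h = x" by (rule pullback_ext[OF R, where X = T]) (simp_all add: x0 h(2))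
    then show "\<exists>h\<in>Hom C T K. n \<cdot> h = x" using h(1) by blast
  next
    fix T x y assume x: "x \<in> Hom C T K" and y: "y \<in> Hom C T K" and eq: "n \<cdot> x = n \<cdot> y"
    note [simp] = HomD[OF x] HomD[OF y]
    have "r2 \<cdot> (n \<cdot> x) = r2 \<cdot> (n \<cdot> y)" using eq by (rule arg_cong)
    then have "k \<cdot> x = k \<cdot> y" by simp
    then show "x = y" by (rule ker_ext[OF k x y])
  qed simp_all
  then show ?thesis unfolding normalisation_def by (intro exI[of _ n]) simp
qed

end

subsection \<open>Reflexive graphs satisfying the Peiffer condition\<close>

text \<open>The Peiffer condition is stated on generalised elements of \<open>Y \<flat> X\<close>.\<close>

locale peiffer_graph = semi_abelian_category C
  for C :: "('o, 'm, 'z) choice_cat_scheme" (structure) +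
  fixes A X G :: 'o and p s \<kappa> c :: 'm
  assumes point: "is_point C G p s A"
    and ker: "is_kernel C X \<kappa> p"
    and c: "c \<in> Hom C G A" "c \<cdot> s = ide A"
    and peiffer: "\<And>T Y y h. y \<in> Hom C Y X \<Longrightarrow> h \<in> Hom C T (Y \<amalg> X) \<Longrightarrow>
      cop (ide Y) (zero X Y) \<cdot> h = zero T Y \<Longrightarrow>
      cop (s \<cdot> (c \<cdot> (\<kappa> \<cdot> y))) \<kappa> \<cdot> h = \<kappa> \<cdot> (cop y (ide X) \<cdot> h)"
begin

lemmas graph_arr [simp] = pointD[OF point] kerD[OF ker] HomD[OF c(1)] c(2)
  reassoc[OF pointD(9)[OF point]] reassoc[OF kerD(6)[OF ker]] reassoc[OF c(2)]

text \<open>When the graph is a groupoid, \<open>\<omega>(x, y)\<close> is the composite of \<open>x\<^sup>-\<^sup>1 : c x \<rightarrow> 0\<close> and \<open>y : 0 \<rightarrow> c y\<close>.\<close>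

lemma division:
  obtains \<omega> where "\<omega> \<in> Hom C (Prod C X X) G" "\<omega> \<cdot> pr (zero X X) (ide X) = \<kappa>"
    "p \<cdot> \<omega> = c \<cdot> (\<kappa> \<cdot> Fst C X X)" "c \<cdot> \<omega> = c \<cdot> (\<kappa> \<cdot> Snd C X X)"
proof -
  have pt: "is_point C (Prod C X X) (Fst C X X) (pr (ide X) (ide X)) X" by (rule prod_point) simp
  have k: "is_kernel C X (pr (zero X X) (ide X)) (Fst C X X)" by (rule prod_kernel) simp_all
  \<comment> \<open>The values are forced: \<omega>(x, x) is the identity arrow at
    \<open>c x\<close>, and \<omega>(0, y) is \<open>y\<close>. They extend to
    \<open>X \<times> X\<close> because Peiffer, at the identity of \<open>X\<close>, rewrites
    \<open>[s c \<kappa>, \<kappa>]\<close> as \<kappa> after the codiagonal, and the codiagonal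
    vanishes on the kernel in question.\<close>
  obtain \<omega> where \<omega>: "\<omega> \<in> Hom C (Prod C X X) G" "\<omega> \<cdot> pr (ide X) (ide X) = s \<cdot> (c \<cdot> \<kappa>)"
      "\<omega> \<cdot> pr (zero X X) (ide X) = \<kappa>"
  proof (rule point_extension[OF pt k, of "s \<cdot> (c \<cdot> \<kappa>)" G \<kappa>])
    fix T h assume h: "h \<in> Hom C T (X \<amalg> X)"
      and eq: "cop (pr (ide X) (ide X)) (pr (zero X X) (ide X)) \<cdot> h = zero T (Prod C X X)"
    note [simp] = HomD[OF h]
    have "Fst C X X \<cdot> (cop (pr (ide X) (ide X)) (pr (zero X X) (ide X)) \<cdot> h) = zero T X"
      "Snd C X X \<cdot> (cop (pr (ide X) (ide X)) (pr (zero X X) (ide X)) \<cdot> h) = zero T X"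
      unfolding eq by simp_all
    then have "cop (ide X) (zero X X) \<cdot> h = zero T X" "cop (ide X) (ide X) \<cdot> h = zero T X" by simp_all
    then show "cop (s \<cdot> (c \<cdot> \<kappa>)) \<kappa> \<cdot> h = zero T G" using peiffer[of "ide X" X h T] by simp
  qed (use that in simp_all)
  note [simp] = HomD[OF \<omega>(1)] \<omega>(2,3)
  show thesis
  proof (rule that[OF \<omega>(1,3)])
    show "p \<cdot> \<omega> = c \<cdot> (\<kappa> \<cdot> Fst C X X)" "c \<cdot> \<omega> = c \<cdot> (\<kappa> \<cdot> Snd C X X)"
      by (rule point_ext[OF pt k, where Y = A]; simp)+
  qed
qed

text \<open>In a groupoid, an arrow \<open>g\<close> starting at \<open>c x\<close> is \<omega>(x,
  y) with \<open>y\<close> the composite of \<open>x\<close> and \<open>g\<close>. Here this is the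
  invertibility of the comparison \<open>m\<close> from \<open>X \<times> X\<close> to the pullback
  of \<open>c \<kappa>\<close> and \<open>p\<close>: both are points over \<open>X\<close> with
  kernel \<open>X\<close>, and \<open>m\<close> is the identity on kernels.\<close>

lemma division_pullback:
  assumes \<omega>: "\<omega> \<in> Hom C (Prod C X X) G" "\<omega> \<cdot> pr (zero X X) (ide X) = \<kappa>" "p \<cdot> \<omega> = c \<cdot> (\<kappa> \<cdot> Fst C X X)"
    and x: "x \<in> Hom C T X" and g: "g \<in> Hom C T G" and xg: "c \<cdot> (\<kappa> \<cdot> x) = p \<cdot> g"
  obtains y where "y \<in> Hom C T X" "\<omega> \<cdot> pr x y = g"
proof -
  note [simp] = HomD[OF \<omega>(1)] HomD[OF x] HomD[OF g]
  have "c \<cdot> \<kappa> \<in> Ar C" "p \<in> Ar C" "Cod C (c \<cdot> \<kappa>) = Cod C p" by simp_all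
  from pullback_exists[OF this] obtain V v w where V: "is_pullback C V v w (c \<cdot> \<kappa>) p" .
  have [simp]: "V \<in> Ob C" "v \<in> Ar C" "Dom C v = V" "Cod C v = X" "w \<in> Ar C" "Dom C w = V" "Cod C w = G"
    using pullbackD[OF V] by simp_all
  have vw: "c \<cdot> (\<kappa> \<cdot> v) = p \<cdot> w" using pullbackD(11)[OF V] by simp
  obtain m where m: "m \<in> Hom C (Prod C X X) V" "v \<cdot> m = Fst C X X" "w \<cdot> m = \<omega>"
    by (rule pullback_lift[OF V, of "Fst C X X" "Prod C X X" \<omega>]) (simp_all add: \<omega>(3))
  note [simp] = HomD[OF m(1)] m(2,3) reassoc[OF m(2)] reassoc[OF m(3)]
  let ?k = "pr (zero X X) (ide X)"
  have pt: "is_point C (Prod C X X) (Fst C X X) (pr (ide X) (ide X)) X" by (rule prod_point) simp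
  have k: "is_kernel C X ?k (Fst C X X)" by (rule prod_kernel) simp_all
  have wk: "\<omega> \<cdot> pr (zero S X) h = \<kappa> \<cdot> h" if h: "h \<in> Hom C S X" for S h
    using reassoc[OF \<omega>(2), of h] h HomD[OF h] by simp
  have km: "is_kernel C X (m \<cdot> ?k) v"
  proof (rule kerI)
    fix S z assume z: "z \<in> Hom C S (Dom C v)" and "v \<cdot> z = zero S (Cod C v)"
    then have z0: "v \<cdot> z = zero S X" by simp
    note [simp] = HomD[OF z, simplified]
    have "p \<cdot> (w \<cdot> z) = (c \<cdot> (\<kappa> \<cdot> v)) \<cdot> z" unfolding vw by simp
    also have "\<dots> = zero S A" by (simp add: z0)
    finally obtain h where h: "h \<in> Hom C S X" "\<kappa> \<cdot> h = w \<cdot> z"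
      using ker_lift[OF ker, of "w \<cdot> z" S] by auto
    note [simp] = HomD[OF h(1)]
    have "(m \<cdot> ?k) \<cdot> h = z" by (rule pullback_ext[OF V, where X = S]) (simp_all add: z0 wk h(2))
    then show "\<exists>h\<in>Hom C S X. (m \<cdot> ?k) \<cdot> h = z" using h(1) by blast
  next
    fix S y z assume y: "y \<in> Hom C S X" and z: "z \<in> Hom C S X" and eq: "(m \<cdot> ?k) \<cdot> y = (m \<cdot> ?k) \<cdot> z"
    note [simp] = HomD[OF y] HomD[OF z]
    have "w \<cdot> ((m \<cdot> ?k) \<cdot> y) = w \<cdot> ((m \<cdot> ?k) \<cdot> z)" using eq by (rule arg_cong)
    then have "\<kappa> \<cdot> y = \<kappa> \<cdot> z" by (simp add: wk)
    then show "y = z" by (rule ker_ext[OF ker y z])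
  qed simp_all
  have "is_iso C m"
    by (rule point_iso[OF pt _ _ _ _ k km, where s' = "m \<cdot> pr (ide X) (ide X)"]) (simp_all add: is_point_def)
  then obtain m' where m': "m' \<in> Hom C V (Prod C X X)" "m \<cdot> m' = ide V" by (auto elim: isoD)
  obtain t where t: "t \<in> Hom C T V" "v \<cdot> t = x" "w \<cdot> t = g"
    by (rule pullback_lift[OF V, of x T g]) (simp_all add: xg)
  note [simp] = HomD[OF m'(1)] HomD[OF t(1)] m'(2) reassoc[OF m'(2)] t(2,3)
  have "Fst C X X \<cdot> (m' \<cdot> t) = v \<cdot> (m \<cdot> (m' \<cdot> t))" by (simp del: m'(2) reassoc[OF m'(2)])
  also have "\<dots> = x" by (simp del: reassoc[OF m(2)])
  finally have "pr x (Snd C X X \<cdot> (m' \<cdot> t)) = m' \<cdot> t" using pair_ext[of "pr x (Snd C X X \<cdot> (m' \<cdot> t))" T X X "m' \<cdot> t"] by simp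
  moreover have "\<omega> \<cdot> (m' \<cdot> t) = w \<cdot> (m \<cdot> (m' \<cdot> t))" by (simp del: m'(2) reassoc[OF m'(2)])
  moreover have "\<dots> = g" by (simp del: reassoc[OF m(3)])
  ultimately show thesis by (intro that[of "Snd C X X \<cdot> (m' \<cdot> t)"]) simp_all
qed

text \<open>The image of \<open>(p, c)\<close> is a symmetric relation, so the domain of an arrow \<open>a \<rightarrow> 0\<close> is locally also the
  codomain of an arrow \<open>0 \<rightarrow> a\<close>.\<close>

lemma ker_c_cover:
  obtains T t x where "regular_epi C t" "t \<in> Hom C T (Ker C c)" "x \<in> Hom C T X"
    "c \<cdot> (\<kappa> \<cdot> x) = p \<cdot> (ker C c \<cdot> t)"
proof -
  have "is_kernel C (Ker C c) (ker C c) c" by (rule Ker) simp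
  note [simp] = kerD[OF this] reassoc[OF kerD(6)[OF this]]
  obtain R e r1 r2 where e: "regular_epi C e" "e \<in> Hom C G R" and re: "r1 \<cdot> e = p" "r2 \<cdot> e = c"
    and R: "equivalence_relation C R r1 r2 A"
    by (rule reflexive_graph_image[of p G A c s]) simp_all
  have [simp]: "R \<in> Ob C" "r1 \<in> Ar C" "Dom C r1 = R" "Cod C r1 = A" "r2 \<in> Ar C" "Dom C r2 = R" "Cod C r2 = A"
    using R by (auto simp: equivalence_relation_def)
  note [simp] = HomD[OF e(2)]
  obtain \<sigma> where \<sigma>: "\<sigma> \<in> Hom C R R" "r1 \<cdot> \<sigma> = r2" "r2 \<cdot> \<sigma> = r1"
    using R unfolding equivalence_relation_def by blast
  note [simp] = HomD[OF \<sigma>(1)]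
  obtain T t b where t: "regular_epi C t" "t \<in> Hom C T (Ker C c)" "b \<in> Hom C T G"
    and b: "e \<cdot> b = (\<sigma> \<cdot> (e \<cdot> ker C c)) \<cdot> t"
    using regular_epi_cover[OF e(1), of "\<sigma> \<cdot> (e \<cdot> ker C c)" "Ker C c"] by auto
  note [simp] = HomD[OF t(2)] HomD[OF t(3)]
  have "p \<cdot> b = r1 \<cdot> (e \<cdot> b)" unfolding re(1)[symmetric] by simp
  also have "\<dots> = zero T A" unfolding b by (simp add: reassoc[OF \<sigma>(2)] reassoc[OF re(2)])
  finally obtain x where x: "x \<in> Hom C T X" "\<kappa> \<cdot> x = b"
    using ker_lift[OF ker, of b T] by auto
  have "c \<cdot> b = r2 \<cdot> (e \<cdot> b)" unfolding re(2)[symmetric] by simp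
  also have "\<dots> = p \<cdot> (ker C c \<cdot> t)" unfolding b by (simp add: reassoc[OF \<sigma>(3)] reassoc[OF re(1)])
  finally show thesis using that[OF t(1,2) x(1)] x(2) by simp
qed

text \<open>An element of \<open>ker c\<close> is locally \<omega>(x, y) with
  \<open>c \<kappa> y = 0\<close>. For such a \<open>y\<close> the Peiffer condition says that
  conjugation by \<open>y\<close> is trivial on \<open>X\<close>, so \<open>y\<close> and
  \<open>X\<close> commute; the division map transports this from \<open>y\<close> to \<omega>(x,
  y).\<close>

lemma ker_c_huq_commute: "huq_commute C X \<kappa> (Ker C c) (ker C c) G"
proof -
  have "is_kernel C (Ker C c) (ker C c) c" by (rule Ker) simp
  note [simp] = kerD[OF this] reassoc[OF kerD(6)[OF this]]
  obtain T t x where t: "regular_epi C t" "t \<in> Hom C T (Ker C c)" and x: "x \<in> Hom C T X"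
    and eq: "c \<cdot> (\<kappa> \<cdot> x) = p \<cdot> (ker C c \<cdot> t)" by (rule ker_c_cover)
  note [simp] = HomD[OF t(2)] HomD[OF x]
  obtain \<omega> where \<omega>: "\<omega> \<in> Hom C (Prod C X X) G" "\<omega> \<cdot> pr (zero X X) (ide X) = \<kappa>"
    "p \<cdot> \<omega> = c \<cdot> (\<kappa> \<cdot> Fst C X X)" "c \<cdot> \<omega> = c \<cdot> (\<kappa> \<cdot> Snd C X X)" by (rule division)
  note [simp] = HomD[OF \<omega>(1)]
  obtain y where y: "y \<in> Hom C T X" "\<omega> \<cdot> pr x y = ker C c \<cdot> t"
    by (rule division_pullback[OF \<omega>(1-3) x _ eq]) simp_all
  note [simp] = HomD[OF y(1)]
  have "c \<cdot> (\<kappa> \<cdot> y) = (c \<cdot> \<omega>) \<cdot> pr x y" unfolding \<omega>(4) by simp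
  also have "\<dots> = zero T A" by (simp add: y(2))
  finally have cy: "c \<cdot> (\<kappa> \<cdot> y) = zero T A" .
  have pt: "is_point C (Prod C T X) (Fst C T X) (pr (ide T) (zero T X)) T" by (rule prod_point) simp
  have k: "is_kernel C X (pr (zero X T) (ide X)) (Fst C T X)" by (rule prod_kernel) simp_all
  \<comment> \<open>\<open>m\<close> multiplies \<open>y\<close> by an element of \<open>X\<close>.
    On the kernel to be checked, Peiffer replaces \<open>[y, 1]\<close> by \<open>[0, 1]\<close>,
    since \<open>c \<kappa> y = 0\<close>, and \<open>[0, 1]\<close> vanishes there.\<close>
  obtain m where m: "m \<in> Hom C (Prod C T X) X" "m \<cdot> pr (ide T) (zero T X) = y"
    "m \<cdot> pr (zero X T) (ide X) = ide X"
  proof (rule point_extension[OF pt k, of y X "ide X"])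
    fix S h assume h: "h \<in> Hom C S (T \<amalg> X)"
      and eq: "cop (pr (ide T) (zero T X)) (pr (zero X T) (ide X)) \<cdot> h = zero S (Prod C T X)"
    note [simp] = HomD[OF h]
    have "Fst C T X \<cdot> (cop (pr (ide T) (zero T X)) (pr (zero X T) (ide X)) \<cdot> h) = zero S T"
      "Snd C T X \<cdot> (cop (pr (ide T) (zero T X)) (pr (zero X T) (ide X)) \<cdot> h) = zero S X"
      unfolding eq by simp_all
    then have h0: "cop (ide T) (zero X T) \<cdot> h = zero S T" "cop (zero T X) (ide X) \<cdot> h = zero S X" by simp_all
    have "\<kappa> \<cdot> (cop y (ide X) \<cdot> h) = cop (zero T G) \<kappa> \<cdot> h"
      using peiffer[OF y(1) h h0(1)] by (simp add: cy)
    also have "\<dots> = \<kappa> \<cdot> (cop (zero T X) (ide X) \<cdot> h)" by simp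
    also have "\<dots> = \<kappa> \<cdot> zero S X" unfolding h0(2) ..
    finally show "cop y (ide X) \<cdot> h = zero S X"
      using ker_ext[OF ker, of "cop y (ide X) \<cdot> h" S "zero S X"] by simp
  qed (use that in simp_all)
  note [simp] = HomD[OF m(1)]
  \<comment> \<open>In elements \<phi>(z, t) = \<omega>(x(t), m(t, z)): at t = 0 this is \<omega>(0,
    z) = \<kappa>(z), and at z = 0 it is \<omega>(x, y), the given element of
    \<open>ker c\<close>.\<close>
  let ?\<phi> = "\<omega> \<cdot> pr (x \<cdot> Snd C X T) (m \<cdot> pr (Snd C X T) (Fst C X T))"
  show ?thesis
    by (rule huq_commute_cover[OF t, where \<phi> = ?\<phi>]) (simp_all add: m(2,3) \<omega>(2) y(2))
qed

text \<open>In group terms: \<open>g\<close> and \<open>s (c g)\<close> conjugate \<open>X\<close> in the same way.\<close>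

lemma conjugation_through_c:
  assumes sh: "smith_is_huq C" and f: "f \<in> Hom C Y G" and h: "h \<in> Hom C T (Y \<amalg> X)"
    and hk: "cop (ide Y) (zero X Y) \<cdot> h = zero T Y"
  shows "cop f \<kappa> \<cdot> h = cop (s \<cdot> (c \<cdot> f)) \<kappa> \<cdot> h"
proof -
  note [simp] = HomD[OF f] HomD[OF h]
  obtain R r1 r2 where R: "is_pullback C R r1 r2 p p" using pullback_exists[of p p] by auto
  obtain S s1 s2 where S: "is_pullback C S s1 s2 c c" using pullback_exists[of c c] by auto
  note [simp] = pullbackD(1,5-6,8-9)[OF R] pullbackD(1,5-6,8-9)[OF S]
  have [simp]: "Cod C r1 = G" "Cod C r2 = G" "Cod C s1 = G" "Cod C s2 = G"
    using pullbackD(7,10)[OF R] pullbackD(7,10)[OF S] by simp_all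
  have "is_kernel C (Ker C c) (ker C c) c" by (rule Ker) simp
  then have "smith_centralise C R r1 r2 S s1 s2 G"
    using sh kernel_pair_equivalence[OF R] kernel_pair_equivalence[OF S] ker_c_huq_commute
      kernel_pair_normalisation[OF R ker] kernel_pair_normalisation[OF S]
    unfolding smith_is_huq_def graph_arr by blast
  then obtain P u v dR dS a b \<theta> where P: "is_pullback C P u v r2 s1"
    and d: "dR \<in> Hom C G R" "r1 \<cdot> dR = ide G" "r2 \<cdot> dR = ide G"
      "dS \<in> Hom C G S" "s1 \<cdot> dS = ide G" "s2 \<cdot> dS = ide G"
    and a: "a \<in> Hom C R P" "u \<cdot> a = ide R" "v \<cdot> a = dS \<cdot> r2"
    and b: "b \<in> Hom C S P" "u \<cdot> b = dR \<cdot> s1" "v \<cdot> b = ide S"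
    and \<theta>: "\<theta> \<in> Hom C P G" "\<theta> \<cdot> a = r1" "\<theta> \<cdot> b = s2"
    unfolding smith_centralise_def by blast
  have [simp]: "P \<in> Ob C" "u \<in> Ar C" "Dom C u = P" "Cod C u = R" "v \<in> Ar C" "Dom C v = P" "Cod C v = S"
    using pullbackD(1,5-10)[OF P] by simp_all
  note uv = pullbackD(11)[OF P]
  note [simp] = HomD[OF d(1)] HomD[OF d(4)] HomD[OF a(1)] HomD[OF b(1)] HomD[OF \<theta>(1)]
    a(2,3) b(2,3) \<theta>(2,3) reassoc[OF a(2)] reassoc[OF a(3)] reassoc[OF b(2)] reassoc[OF b(3)]
    reassoc[OF \<theta>(2)] reassoc[OF \<theta>(3)] reassoc[OF d(2)]
  \<comment> \<open>\<sigma> is the pair \<open>(s c f, f)\<close>, which lies in the kernel pair of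
    \<open>c\<close> because \<open>c s = 1\<close>; \<rho> below is the pair
    \<open>(\<kappa>, 0)\<close> in the kernel pair of \<open>p\<close>.\<close>
  obtain \<sigma> where \<sigma>: "\<sigma> \<in> Hom C Y S" "s1 \<cdot> \<sigma> = s \<cdot> (c \<cdot> f)" "s2 \<cdot> \<sigma> = f"
    by (rule pullback_lift[OF S, of "s \<cdot> (c \<cdot> f)" Y f]) simp_all
  obtain \<rho> where \<rho>: "\<rho> \<in> Hom C X R" "r1 \<cdot> \<rho> = \<kappa>" "r2 \<cdot> \<rho> = zero X G"
    by (rule pullback_lift[OF R, of \<kappa> X "zero X G"]) simp_all
  note [simp] = HomD[OF \<sigma>(1)] HomD[OF \<rho>(1)] \<sigma>(2,3) \<rho>(2,3)
  \<comment> \<open>\<theta> takes \<open>?\<Phi>\<close> to \<open>[f, \<kappa>]\<close>, while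
    \<open>r1 \<cdot> u\<close> takes it to \<open>[s c f, \<kappa>]\<close>. The two agree on the
    image of \<open>a\<close>, and \<open>?\<Phi> \<cdot> h\<close> lies in that image: its
    \<open>S\<close>-component is \<sigma> applied to the \<open>Y\<close>-part of \<open>h\<close>,
    which is zero.\<close>
  let ?\<Phi> = "cop (b \<cdot> \<sigma>) (a \<cdot> \<rho>)"
  have "v \<cdot> (?\<Phi> \<cdot> h) = \<sigma> \<cdot> (cop (ide Y) (zero X Y) \<cdot> h)" by simp
  also have "\<dots> = zero T S" unfolding hk by simp
  finally have v0: "v \<cdot> (?\<Phi> \<cdot> h) = zero T S" .
  have "r2 \<cdot> (u \<cdot> (?\<Phi> \<cdot> h)) = s1 \<cdot> (v \<cdot> (?\<Phi> \<cdot> h))"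
    using arg_cong[OF uv, of "\<lambda>z. z \<cdot> (?\<Phi> \<cdot> h)"] by (simp del: comp_copair comp_copair_comp)
  also have "\<dots> = zero T G" unfolding v0 by simp
  finally have r0: "r2 \<cdot> (u \<cdot> (?\<Phi> \<cdot> h)) = zero T G" .
  have "?\<Phi> \<cdot> h = a \<cdot> (u \<cdot> (?\<Phi> \<cdot> h))"
    by (rule pullback_ext[OF P, where X = T])
      (simp_all add: v0 r0 del: comp_copair comp_copair_comp)
  from arg_cong[OF this, of "\<lambda>z. \<theta> \<cdot> z"]
  have "\<theta> \<cdot> (?\<Phi> \<cdot> h) = r1 \<cdot> (u \<cdot> (?\<Phi> \<cdot> h))"
    by (simp del: comp_copair comp_copair_comp)
  moreover have "\<theta> \<cdot> (?\<Phi> \<cdot> h) = cop f \<kappa> \<cdot> h" by simp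
  moreover have "r1 \<cdot> (u \<cdot> (?\<Phi> \<cdot> h)) = cop (s \<cdot> (c \<cdot> f)) \<kappa> \<cdot> h" by simp
  ultimately show ?thesis by simp
qed

end

context semi_abelian_category
begin

subsection \<open>Crossed modules\<close>

text \<open>Inside the semidirect product the action becomes conjugation. As \<kappa> is monic
  there, equations between actions can be verified after embedding in \<open>G\<close>.\<close>

lemma action_semidirect:
  assumes act: "internal_action C A X \<xi>" and s: "s \<in> Hom C A G" and \<kappa>: "\<kappa> \<in> Hom C X G"
    and eq: "cop s \<kappa> \<cdot> fk A X = \<kappa> \<cdot> \<xi>"
    and f: "f \<in> Hom C Y A" and h: "h \<in> Hom C T (fl Y X)"
  shows "\<kappa> \<cdot> (\<xi> \<cdot> (fm f (ide X) \<cdot> h)) = cop (s \<cdot> f) \<kappa> \<cdot> (fk Y X \<cdot> h)"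
proof -
  note [simp] = actionD(1-5)[OF act] HomD[OF s] HomD[OF \<kappa>] HomD[OF f] HomD[OF h]
  have "\<kappa> \<cdot> (\<xi> \<cdot> (fm f (ide X) \<cdot> h)) = (cop s \<kappa> \<cdot> fk A X) \<cdot> (fm f (ide X) \<cdot> h)"
    unfolding eq by simp
  then show ?thesis by simp
qed

lemma crossed_moduleD:
  assumes "crossed_module C X A \<mu> \<xi>"
  shows "\<mu> \<in> Hom C X A" "internal_action C A X \<xi>"
    "\<xi> \<cdot> fm \<mu> (ide X) = conj_action C X" "\<mu> \<cdot> \<xi> = cop (ide A) \<mu> \<cdot> fk A X"
proof -
  show \<mu>: "\<mu> \<in> Hom C X A" and "internal_action C A X \<xi>" and "\<xi> \<cdot> fm \<mu> (ide X) = conj_action C X"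
    using assms by (simp_all add: crossed_module_def)
  have "\<mu> \<cdot> \<xi> = conj_action C A \<cdot> fm (ide A) \<mu>" using assms by (simp add: crossed_module_def)
  also have "\<dots> = cop (ide A) \<mu> \<cdot> fk A X" using HomD[OF \<mu>] by (simp add: conj_action_def)
  finally show "\<mu> \<cdot> \<xi> = cop (ide A) \<mu> \<cdot> fk A X" .
qed

text \<open>The two crossed module laws have separate roles. Equivariance of \<mu> is the condition
  under which \<open>ide A\<close> and \<mu> together induce \<open>c\<close> on \<open>G\<close>.
  The law for \<open>\<xi> \<cdot> fm \<mu> (ide X)\<close>, composed with
  \<open>fm y (ide X)\<close>, is the Peiffer assumption, once \<open>h\<close> is lifted to
  \<open>Y \<flat> X\<close>.\<close>

lemma crossed_module_graph:
  assumes cm: "crossed_module C X A \<mu> \<xi>"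
  obtains G p s \<kappa> c where "peiffer_graph C A X G p s \<kappa> c" "c \<cdot> \<kappa> = \<mu>" "cop s \<kappa> \<cdot> fk A X = \<kappa> \<cdot> \<xi>"
proof -
  note act = crossed_moduleD(2)[OF cm]
  note [simp] = HomD[OF crossed_moduleD(1)[OF cm]] actionD(1-5)[OF act]
  obtain G p s \<kappa> where pt: "is_point C G p s A" and k: "is_kernel C X \<kappa> p"
    and eq: "cop s \<kappa> \<cdot> fk A X = \<kappa> \<cdot> \<xi>"
    and ext: "\<And>Y f g. f \<in> Hom C A Y \<Longrightarrow> g \<in> Hom C X Y \<Longrightarrow> cop f g \<cdot> fk A X = g \<cdot> \<xi> \<Longrightarrow>
      \<exists>h\<in>Hom C G Y. h \<cdot> s = f \<and> h \<cdot> \<kappa> = g"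
    by (rule semidirect_product[OF act]) blast
  note [simp] = pointD[OF pt] kerD[OF k]
  obtain c where c: "c \<in> Hom C G A" "c \<cdot> s = ide A" "c \<cdot> \<kappa> = \<mu>"
    using ext[of "ide A" A \<mu>] crossed_moduleD(4)[OF cm] by auto
  have "peiffer_graph C A X G p s \<kappa> c"
  proof unfold_locales
    fix T Y y h assume y: "y \<in> Hom C Y X" and h: "h \<in> Hom C T (Y \<amalg> X)"
      and h0: "cop (ide Y) (zero X Y) \<cdot> h = zero T Y"
    note [simp] = HomD[OF y] HomD[OF c(1)]
    obtain h' where h': "h' \<in> Hom C T (fl Y X)" "fk Y X \<cdot> h' = h"
      by (rule flat_lift[OF h h0]) simp_all
    note [simp] = HomD[OF h'(1)]
    have "cop (s \<cdot> (c \<cdot> (\<kappa> \<cdot> y))) \<kappa> \<cdot> h = cop (s \<cdot> (\<mu> \<cdot> y)) \<kappa> \<cdot> (fk Y X \<cdot> h')"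
      unfolding h'(2) c(3)[symmetric] by simp
    also have "\<dots> = \<kappa> \<cdot> (\<xi> \<cdot> (fm (\<mu> \<cdot> y) (ide X) \<cdot> h'))"
      by (rule action_semidirect[OF act _ _ eq _ h'(1), symmetric]) simp_all
    also have "\<dots> = \<kappa> \<cdot> ((\<xi> \<cdot> fm \<mu> (ide X)) \<cdot> (fm y (ide X) \<cdot> h'))"
      using reassoc[OF flat_map_comp[of \<mu> "ide X" y "ide X"], of h'] by simp
    also have "\<dots> = \<kappa> \<cdot> (cop y (ide X) \<cdot> (fk Y X \<cdot> h'))"
      unfolding crossed_moduleD(3)[OF cm] by (simp add: conj_action_def)
    finally show "cop (s \<cdot> (c \<cdot> (\<kappa> \<cdot> y))) \<kappa> \<cdot> h = \<kappa> \<cdot> (cop y (ide X) \<cdot> h)" unfolding h'(2) .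
  qed (use pt k c in simp_all)
  then show thesis by (rule that[OF _ c(3) eq])
qed

section \<open>Cosmash products and the folding morphisms\<close>

lemma coprod_to_prod_arr [simp]:
  assumes "A \<in> Ob C" "B \<in> Ob C"
  shows "coprod_to_prod C A B \<in> Ar C" "Dom C (coprod_to_prod C A B) = A \<amalg> B"
    "Cod C (coprod_to_prod C A B) = Prod C A B"
  using assms by (simp_all add: coprod_to_prod_def)

lemma cosmash_kernel:
  assumes "A \<in> Ob C" "B \<in> Ob C"
  shows "is_kernel C (cosmash C A B) (cosmash_ker C A B) (coprod_to_prod C A B)"
  unfolding cosmash_def cosmash_ker_def by (rule Ker) (use assms in simp)

lemma cosmash_to_flat_arr [simp]:
  assumes "A \<in> Ob C" "B \<in> Ob C"
  shows "cosmash_to_flat C A B \<in> Ar C" "Dom C (cosmash_to_flat C A B) = cosmash C A B"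
    "Cod C (cosmash_to_flat C A B) = fl A B" "fk A B \<cdot> cosmash_to_flat C A B = cosmash_ker C A B"
proof -
  note [simp] = assms kerD(2-5)[OF cosmash_kernel[OF assms]]
  have "Fst C A B \<cdot> (coprod_to_prod C A B \<cdot> cosmash_ker C A B) = zero (cosmash C A B) A"
    using kerD(6)[OF cosmash_kernel[OF assms]] by simp
  then have "cop (ide A) (zero B A) \<cdot> cosmash_ker C A B = zero (cosmash C A B) A"
    by (simp add: coprod_to_prod_def)
  then have "cosmash_to_flat C A B \<in> Hom C (cosmash C A B) (fl A B) \<and>
    fk A B \<cdot> cosmash_to_flat C A B = cosmash_ker C A B"
    unfolding cosmash_to_flat_def by (intro flat_the) simp_all
  then show "cosmash_to_flat C A B \<in> Ar C" "Dom C (cosmash_to_flat C A B) = cosmash C A B"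
    "Cod C (cosmash_to_flat C A B) = fl A B" "fk A B \<cdot> cosmash_to_flat C A B = cosmash_ker C A B"
    by simp_all
qed

lemma cosmash3_arr:
  assumes ob: "A \<in> Ob C" "B \<in> Ob C" "D \<in> Ob C"
  shows "cosmash3 C A B D \<in> Ob C"
    "cosmash3_ker C A B D \<in> Hom C (cosmash3 C A B D) (A \<amalg> B \<amalg> D)"
    "cop (ide (A \<amalg> B)) (zero D (A \<amalg> B)) \<cdot> cosmash3_ker C A B D = zero (cosmash3 C A B D) (A \<amalg> B)"
    "cop (cop (In1 C A D) (zero B (A \<amalg> D))) (In2 C A D) \<cdot> cosmash3_ker C A B D =
      zero (cosmash3 C A B D) (A \<amalg> D)"
    "cop (cop (zero A (B \<amalg> D)) (In1 C B D)) (In2 C B D) \<cdot> cosmash3_ker C A B D =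
      zero (cosmash3 C A B D) (B \<amalg> D)"
proof -
  let ?f = "coprod3_to_prod C A B D" and ?k = "cosmash3_ker C A B D" and ?K = "cosmash3 C A B D"
  let ?AB = "A \<amalg> B" and ?AD = "A \<amalg> D" and ?BD = "B \<amalg> D"
  note [simp] = ob
  have f: "?f \<in> Ar C" "Dom C ?f = ?AB \<amalg> D" "Cod C ?f = Prod C ?AB (Prod C ?AD ?BD)"
    by (simp_all add: coprod3_to_prod_def)
  have k: "is_kernel C ?K ?k ?f" unfolding cosmash3_def cosmash3_ker_def by (rule Ker) (rule f)
  note [simp] = f kerD(2-5)[OF k]
  show "?K \<in> Ob C" "?k \<in> Hom C ?K (?AB \<amalg> D)" by simp_all
  have "Fst C ?AB (Prod C ?AD ?BD) \<cdot> (?f \<cdot> ?k) = zero ?K ?AB"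
    "Fst C ?AD ?BD \<cdot> (Snd C ?AB (Prod C ?AD ?BD) \<cdot> (?f \<cdot> ?k)) = zero ?K ?AD"
    "Snd C ?AD ?BD \<cdot> (Snd C ?AB (Prod C ?AD ?BD) \<cdot> (?f \<cdot> ?k)) = zero ?K ?BD"
    using kerD(6)[OF k] by simp_all
  then show "cop (ide ?AB) (zero D ?AB) \<cdot> ?k = zero ?K ?AB"
    "cop (cop (In1 C A D) (zero B ?AD)) (In2 C A D) \<cdot> ?k = zero ?K ?AD"
    "cop (cop (zero A ?BD) (In1 C B D)) (In2 C B D) \<cdot> ?k = zero ?K ?BD"
    by (simp_all add: coprod3_to_prod_def)
qed

lemma cosmash3_to_flat:
  assumes ob: "A \<in> Ob C" "B \<in> Ob C" "D \<in> Ob C"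
  shows "cosmash3_to_flat C A B D \<in> Hom C (cosmash3 C A B D) (fl (A \<amalg> B) D)"
    "fk (A \<amalg> B) D \<cdot> cosmash3_to_flat C A B D = cosmash3_ker C A B D"
proof -
  have "cosmash3_to_flat C A B D \<in> Hom C (cosmash3 C A B D) (fl (A \<amalg> B) D) \<and>
    fk (A \<amalg> B) D \<cdot> cosmash3_to_flat C A B D = cosmash3_ker C A B D"
    unfolding cosmash3_to_flat_def by (rule flat_the[OF cosmash3_arr(2,3)[OF ob]]) (use ob in simp_all)
  then show "cosmash3_to_flat C A B D \<in> Hom C (cosmash3 C A B D) (fl (A \<amalg> B) D)"
    "fk (A \<amalg> B) D \<cdot> cosmash3_to_flat C A B D = cosmash3_ker C A B D" by blast+
qed

lemma cosmash_the:
  assumes h: "h \<in> Hom C T (A \<amalg> B)" and ob: "A \<in> Ob C" "B \<in> Ob C"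
    and h0: "cop (ide A) (zero B A) \<cdot> h = zero T A" "cop (zero A B) (ide B) \<cdot> h = zero T B"
  shows "(THE h'. h' \<in> Hom C T (cosmash C A B) \<and> cosmash_ker C A B \<cdot> h' = h) \<in> Hom C T (cosmash C A B) \<and>
    cosmash_ker C A B \<cdot> (THE h'. h' \<in> Hom C T (cosmash C A B) \<and> cosmash_ker C A B \<cdot> h' = h) = h"
proof -
  note [simp] = HomD[OF h] ob
  note k = cosmash_kernel[OF ob]
  have "coprod_to_prod C A B \<cdot> h = zero T (Cod C (coprod_to_prod C A B))"
    by (simp add: coprod_to_prod_def h0)
  then obtain h' where h': "h' \<in> Hom C T (cosmash C A B)" "cosmash_ker C A B \<cdot> h' = h"
    using ker_lift[OF k, of h T] by auto
  have "\<exists>!h'. h' \<in> Hom C T (cosmash C A B) \<and> cosmash_ker C A B \<cdot> h' = h"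
  proof (rule ex1I)
    show "h' \<in> Hom C T (cosmash C A B) \<and> cosmash_ker C A B \<cdot> h' = h" using h' by blast
  next
    fix y assume y: "y \<in> Hom C T (cosmash C A B) \<and> cosmash_ker C A B \<cdot> y = h"
    show "y = h'" by (rule ker_ext[OF k _ h'(1)]) (use y h' in simp_all)
  qed
  then show ?thesis by (rule theI')
qed

lemma fold_outer:
  assumes ob: "A \<in> Ob C" "B \<in> Ob C"
  shows "fold_outer C A B \<in> Hom C (cosmash3 C B A B) (cosmash C A B)"
    "cosmash_ker C A B \<cdot> fold_outer C A B =
      cop (cop (In2 C A B) (In1 C A B)) (In2 C A B) \<cdot> cosmash3_ker C B A B"
proof -
  note [simp] = ob HomD[OF cosmash3_arr(2)[OF ob(2) ob(1) ob(2)]]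
  note c3 = cosmash3_arr(3,4)[OF ob(2) ob(1) ob(2)]
  let ?k = "cosmash3_ker C B A B" and ?K = "cosmash3 C B A B"
  \<comment> \<open>The folded map must vanish in both \<open>A\<close> and \<open>B\<close>. Its
    \<open>A\<close>-component kills the outer copies of \<open>B\<close>, so it factors through the
    projection that drops the last summand; its \<open>B\<close>-component drops \<open>A\<close>
    and then applies the codiagonal of \<open>B\<close>.\<close>
  have "cop (zero B A) (ide A) \<cdot> (cop (ide (B \<amalg> A)) (zero B (B \<amalg> A)) \<cdot> ?k) = zero ?K A"
    "cop (ide B) (ide B) \<cdot> (cop (cop (In1 C B B) (zero A (B \<amalg> B))) (In2 C B B) \<cdot> ?k) = zero ?K B"
    unfolding c3 by simp_all
  then have "fold_outer C A B \<in> Hom C (cosmash3 C B A B) (cosmash C A B) \<and>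
    cosmash_ker C A B \<cdot> fold_outer C A B =
      cop (cop (In2 C A B) (In1 C A B)) (In2 C A B) \<cdot> cosmash3_ker C B A B"
    unfolding fold_outer_def by (intro cosmash_the) simp_all
  then show "fold_outer C A B \<in> Hom C (cosmash3 C B A B) (cosmash C A B)"
    "cosmash_ker C A B \<cdot> fold_outer C A B =
      cop (cop (In2 C A B) (In1 C A B)) (In2 C A B) \<cdot> cosmash3_ker C B A B" by blast+
qed

lemma fold_right:
  assumes ob: "A \<in> Ob C" "B \<in> Ob C"
  shows "fold_right C A B \<in> Hom C (cosmash3 C A B B) (cosmash C A B)"
    "cosmash_ker C A B \<cdot> fold_right C A B =
      cop (cop (In1 C A B) (In2 C A B)) (In2 C A B) \<cdot> cosmash3_ker C A B B"
proof -
  note [simp] = ob HomD[OF cosmash3_arr(2)[OF ob(1) ob(2) ob(2)]]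
  note c3 = cosmash3_arr(3,5)[OF ob(1) ob(2) ob(2)]
  let ?k = "cosmash3_ker C A B B" and ?K = "cosmash3 C A B B"
  have "cop (ide A) (zero B A) \<cdot> (cop (ide (A \<amalg> B)) (zero B (A \<amalg> B)) \<cdot> ?k) = zero ?K A"
    "cop (ide B) (ide B) \<cdot> (cop (cop (zero A (B \<amalg> B)) (In1 C B B)) (In2 C B B) \<cdot> ?k) = zero ?K B"
    unfolding c3 by simp_all
  then have "fold_right C A B \<in> Hom C (cosmash3 C A B B) (cosmash C A B) \<and>
    cosmash_ker C A B \<cdot> fold_right C A B =
      cop (cop (In1 C A B) (In2 C A B)) (In2 C A B) \<cdot> cosmash3_ker C A B B"
    unfolding fold_right_def by (intro cosmash_the) simp_all
  then show "fold_right C A B \<in> Hom C (cosmash3 C A B B) (cosmash C A B)"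
    "cosmash_ker C A B \<cdot> fold_right C A B =
      cop (cop (In1 C A B) (In2 C A B)) (In2 C A B) \<cdot> cosmash3_ker C A B B" by blast+
qed

section \<open>The ternary equations of (CA.0)\<close>

lemma crossed_module_cosmash3_outer:
  assumes sh: "smith_is_huq C" and cm: "crossed_module C M L \<mu> \<xi>" and \<nu>: "\<nu> \<in> Hom C N L"
  shows "\<xi> \<cdot> (fm (cop \<mu> \<nu>) (ide M) \<cdot> cosmash3_to_flat C M N M) =
    \<xi> \<cdot> (fm \<nu> (ide M) \<cdot> (cosmash_to_flat C N M \<cdot> fold_outer C N M))" (is "?l = ?r")
proof -
  obtain G p s \<kappa> c where graph: "peiffer_graph C L M G p s \<kappa> c" and c\<kappa>: "c \<cdot> \<kappa> = \<mu>"
    and eq: "cop s \<kappa> \<cdot> fk L M = \<kappa> \<cdot> \<xi>" by (rule crossed_module_graph[OF cm])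
  interpret peiffer_graph C L M G p s \<kappa> c by (rule graph)
  note act = crossed_moduleD(2)[OF cm]
  note [simp] = HomD[OF crossed_moduleD(1)[OF cm]] HomD[OF \<nu>] actionD(1-5)[OF act] c\<kappa>
  have ob: "M \<in> Ob C" "N \<in> Ob C" by simp_all
  note j = cosmash3_to_flat[OF ob ob(1)] and S = fold_outer[OF ob(2,1)]
  note [simp] = HomD[OF j(1)] HomD[OF S(1)] HomD[OF cosmash3_arr(2)[OF ob ob(1)]]
  let ?k = "cosmash3_ker C M N M"
  have "\<kappa> \<cdot> ?r = cop (s \<cdot> \<nu>) \<kappa> \<cdot> (fk N M \<cdot> (cosmash_to_flat C N M \<cdot> fold_outer C N M))"
    by (rule action_semidirect[OF act _ _ eq \<nu>, where T = "cosmash3 C M N M"]) simp_all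
  \<comment> \<open>Folding sends the first copy of \<open>M\<close> into \<open>G\<close> by
    \<kappa>, whereas the action pulled back from \<open>L\<close> sends it by
    \<open>s \<mu>\<close>. As \<open>c \<kappa> = \<mu>\<close>, the two conjugating maps are
    \<open>g\<close> and \<open>s (c g)\<close>.\<close>
  also have "\<dots> = cop (cop \<kappa> (s \<cdot> \<nu>)) \<kappa> \<cdot> ?k"
    by (simp add: reassoc[OF cosmash_to_flat_arr(4)] S(2))
  also have "\<dots> = cop (s \<cdot> (c \<cdot> cop \<kappa> (s \<cdot> \<nu>))) \<kappa> \<cdot> ?k"
    by (rule conjugation_through_c[OF sh _ cosmash3_arr(2,3)[OF ob ob(1)]]) simp
  also have "\<dots> = cop (s \<cdot> cop \<mu> \<nu>) \<kappa> \<cdot> (fk (M \<amalg> N) M \<cdot> cosmash3_to_flat C M N M)"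
    by (simp add: j(2))
  also have "\<dots> = \<kappa> \<cdot> ?l"
    by (rule action_semidirect[OF act _ _ eq _ j(1), symmetric]) simp_all
  finally show ?thesis using ker_ext[OF ker, of ?l "cosmash3 C M N M" ?r] by simp
qed

lemma crossed_module_cosmash3_right:
  assumes sh: "smith_is_huq C" and cm: "crossed_module C N L \<nu> \<xi>" and \<mu>: "\<mu> \<in> Hom C M L"
  shows "\<xi> \<cdot> (fm (cop \<mu> \<nu>) (ide N) \<cdot> cosmash3_to_flat C M N N) =
    \<xi> \<cdot> (fm \<mu> (ide N) \<cdot> (cosmash_to_flat C M N \<cdot> fold_right C M N))" (is "?l = ?r")
proof -
  obtain G p s \<kappa> c where graph: "peiffer_graph C L N G p s \<kappa> c" and c\<kappa>: "c \<cdot> \<kappa> = \<nu>"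
    and eq: "cop s \<kappa> \<cdot> fk L N = \<kappa> \<cdot> \<xi>" by (rule crossed_module_graph[OF cm])
  interpret peiffer_graph C L N G p s \<kappa> c by (rule graph)
  note act = crossed_moduleD(2)[OF cm]
  note [simp] = HomD[OF crossed_moduleD(1)[OF cm]] HomD[OF \<mu>] actionD(1-5)[OF act] c\<kappa>
  have ob: "M \<in> Ob C" "N \<in> Ob C" by simp_all
  note j = cosmash3_to_flat[OF ob ob(2)] and S = fold_right[OF ob]
  note [simp] = HomD[OF j(1)] HomD[OF S(1)] HomD[OF cosmash3_arr(2)[OF ob ob(2)]]
  let ?k = "cosmash3_ker C M N N"
  have "\<kappa> \<cdot> ?r = cop (s \<cdot> \<mu>) \<kappa> \<cdot> (fk M N \<cdot> (cosmash_to_flat C M N \<cdot> fold_right C M N))"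
    by (rule action_semidirect[OF act _ _ eq \<mu>, where T = "cosmash3 C M N N"]) simp_all
  also have "\<dots> = cop (cop (s \<cdot> \<mu>) \<kappa>) \<kappa> \<cdot> ?k"
    by (simp add: reassoc[OF cosmash_to_flat_arr(4)] S(2))
  also have "\<dots> = cop (s \<cdot> (c \<cdot> cop (s \<cdot> \<mu>) \<kappa>)) \<kappa> \<cdot> ?k"
    by (rule conjugation_through_c[OF sh _ cosmash3_arr(2,3)[OF ob ob(2)]]) simp
  also have "\<dots> = cop (s \<cdot> cop \<mu> \<nu>) \<kappa> \<cdot> (fk (M \<amalg> N) N \<cdot> cosmash3_to_flat C M N N)"
    by (simp add: j(2))
  also have "\<dots> = \<kappa> \<cdot> ?l"
    by (rule action_semidirect[OF act _ _ eq _ j(1), symmetric]) simp_all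
  finally show ?thesis using ker_ext[OF ker, of ?l "cosmash3 C M N N" ?r] by simp
qed

text \<open>On the summand \<open>N \<flat> M\<close> both sides become
  \<open>[\<nu>, \<mu>]\<close> after the kernel, the swap on the right exchanging the two
  components; on \<open>M \<flat> N\<close> both become \<open>[\<mu>, \<nu>]\<close> after the
  kernel.\<close>

lemma crossed_modules_actions_agree:
  assumes cmM: "crossed_module C M L \<mu> \<xi>M" and cmN: "crossed_module C N L \<nu> \<xi>N"
  shows "cop \<mu> \<nu> \<cdot> coprod_map C (\<xi>M \<cdot> fm \<nu> (ide M)) (\<xi>N \<cdot> fm \<mu> (ide N)) = cop \<mu> \<nu> \<cdot> flat_kers C M N"
proof -
  note [simp] = HomD[OF crossed_moduleD(1)[OF cmM]] actionD(1-5)[OF crossed_moduleD(2)[OF cmM]]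
    HomD[OF crossed_moduleD(1)[OF cmN]] actionD(1-5)[OF crossed_moduleD(2)[OF cmN]]
  show ?thesis
    by (simp add: flat_kers_def coprod_swap_def reassoc[OF crossed_moduleD(4)[OF cmM]]
        reassoc[OF crossed_moduleD(4)[OF cmN]])
qed

lemma crossed_modules_compatible:
  assumes sh: "smith_is_huq C"
    and cmM: "crossed_module C M L \<mu> \<xi>M" and cmN: "crossed_module C N L \<nu> \<xi>N"
  shows "compatible_actions C M N (\<xi>N \<cdot> fm \<mu> (ide N)) (\<xi>M \<cdot> fm \<nu> (ide M))"
proof -
  note actM = crossed_moduleD(2)[OF cmM] and actN = crossed_moduleD(2)[OF cmN]
  note \<mu> = crossed_moduleD(1)[OF cmM] and \<nu> = crossed_moduleD(1)[OF cmN]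
  note [simp] = HomD[OF \<mu>] HomD[OF \<nu>] actionD(1-5)[OF actM] actionD(1-5)[OF actN]
  have ob: "M \<in> Ob C" "N \<in> Ob C" by simp_all
  note [simp] = HomD[OF cosmash3_to_flat(1)[OF ob ob(1)]] HomD[OF cosmash3_to_flat(1)[OF ob ob(2)]]
    HomD[OF fold_outer(1)[OF ob(2,1)]] HomD[OF fold_right(1)[OF ob]]
  let ?f = "cop \<mu> \<nu>" and ?\<beta> = "\<xi>M \<cdot> fm \<nu> (ide M)" and ?\<alpha> = "\<xi>N \<cdot> fm \<mu> (ide N)"
  have kers: "flat_kers C M N \<in> Hom C (fl N M \<amalg> fl M N) (M \<amalg> N)"
    by (simp add: flat_kers_def coprod_swap_def)
  note [simp] = HomD[OF kers]
  have agree: "fm ?f (ide X) \<cdot> fm (coprod_map C ?\<beta> ?\<alpha>) (ide X) = fm ?f (ide X) \<cdot> fm (flat_kers C M N) (ide X)"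
    if "X \<in> Ob C" for X
    using that crossed_modules_actions_agree[OF cmM cmN]
    by (simp add: flat_map_comp del: comp_copair copair_coprod_map)
  show ?thesis
    unfolding compatible_actions_def
  proof (intro conjI exI)
    show "internal_action C (M \<amalg> N) M (\<xi>M \<cdot> fm ?f (ide M))"
      by (rule internal_action_pullback[OF actM]) simp
    show "internal_action C (M \<amalg> N) N (\<xi>N \<cdot> fm ?f (ide N))"
      by (rule internal_action_pullback[OF actN]) simp
    show "internal_action C M N ?\<alpha>" by (rule internal_action_pullback[OF actN \<mu>])
    show "internal_action C N M ?\<beta>" by (rule internal_action_pullback[OF actM \<nu>])
    show "(\<xi>M \<cdot> fm ?f (ide M)) \<cdot> fm (In2 C M N) (ide M) = ?\<beta>"
      "(\<xi>N \<cdot> fm ?f (ide N)) \<cdot> fm (In1 C M N) (ide N) = ?\<alpha>" by (simp_all add: flat_map_comp)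
    \<comment> \<open>Along its own inclusion \<open>?f\<close> restricts to \<mu> or to \<nu>, so
      these are the Peiffer laws of the two crossed modules.\<close>
    show "(\<xi>M \<cdot> fm ?f (ide M)) \<cdot> fm (In1 C M N) (ide M) = conj_action C M"
      "(\<xi>N \<cdot> fm ?f (ide N)) \<cdot> fm (In2 C M N) (ide N) = conj_action C N"
      using crossed_moduleD(3)[OF cmM] crossed_moduleD(3)[OF cmN] by (simp_all add: flat_map_comp)
    show "(\<xi>M \<cdot> fm ?f (ide M)) \<cdot> cosmash3_to_flat C M N M = ?\<beta> \<cdot> cosmash_to_flat C N M \<cdot> fold_outer C N M"
      using crossed_module_cosmash3_outer[OF sh cmM \<nu>] by simp
    show "(\<xi>N \<cdot> fm ?f (ide N)) \<cdot> cosmash3_to_flat C M N N = ?\<alpha> \<cdot> cosmash_to_flat C M N \<cdot> fold_right C M N"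
      using crossed_module_cosmash3_right[OF sh cmN \<mu>] by simp
    show "(\<xi>M \<cdot> fm ?f (ide M)) \<cdot> fm (coprod_map C ?\<beta> ?\<alpha>) (ide M) =
        (\<xi>M \<cdot> fm ?f (ide M)) \<cdot> fm (flat_kers C M N) (ide M)"
      "(\<xi>N \<cdot> fm ?f (ide N)) \<cdot> fm (coprod_map C ?\<beta> ?\<alpha>) (ide N) =
        (\<xi>N \<cdot> fm ?f (ide N)) \<cdot> fm (flat_kers C M N) (ide N)"
      using agree[OF ob(1)] agree[OF ob(2)] by simp_all
  qed
qed

end

theorem proposition3p3:
  fixes C :: "('o, 'm, 'z) choice_cat_scheme" (structure)
    and L M N :: 'o and \<mu> \<nu> \<xi>LM \<xi>LN :: 'm
  assumes "semi_abelian C"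
    and "smith_is_huq C"
    and "chosen_limits C"
    and "crossed_module C M L \<mu> \<xi>LM"
    and "crossed_module C N L \<nu> \<xi>LN"
  shows "internal_action C M N (\<xi>LN \<cdot> flat_map C \<mu> (Ide C N)) \<and>
    internal_action C N M (\<xi>LM \<cdot> flat_map C \<nu> (Ide C M)) \<and>
    compatible_actions C M N (\<xi>LN \<cdot> flat_map C \<mu> (Ide C N)) (\<xi>LM \<cdot> flat_map C \<nu> (Ide C M))"
proof -
  interpret semi_abelian_category C
    using assms(1,3) by (simp add: semi_abelian_category_def semi_abelian_category_axioms_def)
  show ?thesis
    using internal_action_pullback crossed_moduleD[OF assms(4)] crossed_moduleD[OF assms(5)]
      crossed_modules_compatible[OF assms(2,4,5)] by blast
qed

end
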